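(* Let $N\ge 2$, let $A\in\mathbb{R}^{n\times n}$, $B\in\mathbb{R}^{n\times 1}$, $C\in\mathbb{R}^{n\times l}$, and let $g\in\mathbb{R}^l$ be a vector such that $g^{\mathrm T}\chi(s)=g^{\mathrm T}C^{\mathrm T}(sI_n-A)^{-1}B$ is hyper-minimum-phase. Let $\mathcal G$ be a unit weighted digraph on $N$ vertices, without self-loops, having at least one directed spanning tree, and let $L$ be its Laplace matrix. Consider the network $$\dot x_i(t)=Ax_i(t)+Bu_i(t),\qquad y_i(t)=C^{\mathrm T}x_i(t),\qquad i=1,\dots,N,$$ with the controller $$u_i(t)=-k\,g^{\mathrm T}\,\overline y_i(t),\qquad \overline y_i(t)=\sum_{j\in\mathcal N_i}(y_i(t)-y_j(t)),\qquad i=1,\dots,N,$$ where $k>0$ is a real number. If $$k>\frac{\varkappa_0}{r(L)},$$ then for every initial condition $x(0)=\mathrm{col}(x_1(0),\dots,x_N(0))\in\mathbb{R}^{nN}$ one has $$\lim_{t\to\infty}(x_i(t)-x_j(t))=0,\qquad i,j=1,\dots,N,$$ and moreover $\lim_{t\to\infty}(x_i(t)-c(t))=0$ for $i=1,\dots,N$, where $$c(t)=\exp(At)\,(v(L)^{\mathrm T}\otimes I_n)\,x(0).$$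
   Context: Digraph conventions: a digraph is $\mathcal G=(\mathcal V,\mathcal E)$ with $\mathcal E\subseteq\mathcal V\times\mathcal V$ and no self-loops. In an arc $(\alpha,\beta)$ the vertex $\beta$ is called the parent (neighbour) of $\alpha$; agents are identified with vertices $1,\dots,N$ and $\mathcal N_i=\{j:(i,j)\in\mathcal E\}$ is the set of neighbours of agent $i$. A directed tree is a digraph in which all vertices except one (the root) have exactly one parent; a directed spanning tree of $\mathcal G$ is a directed tree formed by all vertices of $\mathcal G$ and some of its arcs such that there is a directed path (following arcs $(\alpha,\beta)$ from $\alpha$ to $\beta$) from every vertex to the root. Unit weighted: the adjacency matrix $\mathcal A(\mathcal G)$ has $(i,j)$ entry $1$ if $(i,j)\in\mathcal E$ and $0$ otherwise. The Laplace matrix is $L=\mathrm{diag}(\mathcal A(\mathcal G)\mathbf 1_N)-\mathcal A(\mathcal G)$, where $\mathbf 1_N$ is the all-ones vector. When $\mathcal G$ has a directed spanning tree, $0$ is a simple eigenvalue of $L$ and all other eigenvalues have positive real part; $r(L)=\min_{\lambda\ne 0}\mathrm{Re}\,\lambda$ over nonzero eigenvalues $\lambda$ of $L$. $v(L)\in\mathbb{R}^N$ denotes the left eigenvector of $L$ for eigenvalue $0$ ($v(L)^{\mathrm T}L=0$) normalized by $v(L)^{\mathrm T}\mathbf 1_N=1$. Hyper-minimum-phase: with $\chi(s)=C^{\mathrm T}(sI_n-A)^{-1}B$, the function $g^{\mathrm T}\chi(s)$ is hyper-minimum-phase if its numerator (with respect to the denominator $\det(sI_n-A)$) is a Hurwitz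 polynomial (all roots in the open left half-plane) of degree $n-1$ with positive coefficients. The number $\varkappa_0$ is $$\varkappa_0=\sup_{\omega\in\mathbb{R}}\mathrm{Re}\left(-\big(g^{\mathrm T}\chi(\mathfrak i\omega)\big)^{-1}\right),$$ where $(g^{\mathrm T}\chi)^{-1}$ is the reciprocal rational function, evaluated at $\mathfrak i\omega$, $\mathfrak i^2=-1$. $\otimes$ is the Kronecker product; $\mathrm{col}$ denotes stacking into a column vector. *)

theory Defs
  imports "HOL-Analysis.Analysis" "HOL-Computational_Algebra.Polynomial"
begin

section \<open>Digraphs\<close>

text \<open>
  The vertex set is the whole of a finite type and a digraph is its set of arcs; in an arc
  \<open>(a, b)\<close> the vertex \<open>b\<close> is the parent of \<open>a\<close>.  Having no self-loops is \<^const>\<open>irrefl\<close>.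
\<close>

definition neighbours :: "('v \<times> 'v) set \<Rightarrow> 'v \<Rightarrow> 'v set" where
  "neighbours E i = {j. (i, j) \<in> E}"

text \<open>The exceptional vertex (the root) of a directed tree is read as having no parent at all.\<close>

definition directed_spanning_tree :: "('v \<times> 'v) set \<Rightarrow> ('v \<times> 'v) set \<Rightarrow> 'v \<Rightarrow> bool" where
  "directed_spanning_tree E T r \<longleftrightarrow>
     T \<subseteq> E \<and>
     (\<forall>a. a \<noteq> r \<longrightarrow> (\<exists>!b. (a, b) \<in> T)) \<and>
     (\<forall>b. (r, b) \<notin> T) \<and>
     (\<forall>a. (a, r) \<in> T\<^sup>*)"

definition has_directed_spanning_tree :: "('v \<times> 'v) set \<Rightarrow> bool" where
  "has_directed_spanning_tree E \<longleftrightarrow> (\<exists>T r. directed_spanning_tree E T r)"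

definition adjacency_matrix :: "('v \<times> 'v) set \<Rightarrow> real^'v^'v" where
  "adjacency_matrix E = (\<chi> i j. if (i, j) \<in> E then 1 else 0)"

definition diag :: "'a::zero^'v \<Rightarrow> 'a^'v^'v" where
  "diag d = (\<chi> i j. if i = j then d $ i else 0)"

definition laplace_matrix :: "('v::finite \<times> 'v) set \<Rightarrow> real^'v^'v" where
  "laplace_matrix E = diag (adjacency_matrix E *v 1) - adjacency_matrix E"

section \<open>Matrices\<close>

abbreviation cmatrix :: "real^'n^'m \<Rightarrow> complex^'n^'m" where
  "cmatrix \<equiv> map_matrix complex_of_real"

abbreviation cvector :: "real^'n \<Rightarrow> complex^'n" where
  "cvector v \<equiv> (\<chi> i. complex_of_real (v $ i))"

definition complex_eigenvalue :: "real^'n^'n \<Rightarrow> complex \<Rightarrow> bool" where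
  "complex_eigenvalue M z \<longleftrightarrow> (\<exists>w. w \<noteq> 0 \<and> cmatrix M *v w = z *s w)"

definition r_min :: "real^'n^'n \<Rightarrow> real" where
  "r_min L = Min (Re ` {z. complex_eigenvalue L z \<and> z \<noteq> 0})"

definition left_null_vec :: "real^'n^'n \<Rightarrow> real^'n" where
  "left_null_vec L = (THE v. v v* L = 0 \<and> scalar_product v 1 = 1)"

primrec matrix_power :: "'a::semiring_1^'n^'n \<Rightarrow> nat \<Rightarrow> 'a^'n^'n" where
  "matrix_power M 0 = mat 1"
| "matrix_power M (Suc k) = M ** matrix_power M k"

definition matrix_exp :: "real^'n^'n \<Rightarrow> real^'n^'n" where
  "matrix_exp M = (\<Sum>k. (1 / fact k) *\<^sub>R matrix_power M k)"

text \<open>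
  The rows and columns of a Kronecker product are indexed by pairs, the first component being
  the block index.
\<close>

definition kronecker :: "'a::times^'c::finite^'b::finite \<Rightarrow> 'a^'e::finite^'d::finite \<Rightarrow> 'a^('c \<times> 'e)^('b \<times> 'd)" where
  "kronecker M N = (\<chi> p q. M $ fst p $ fst q * N $ snd p $ snd q)"

definition col :: "('v::finite \<Rightarrow> 'a^'n::finite) \<Rightarrow> 'a^('v \<times> 'n)" where
  "col x = (\<chi> p. x (fst p) $ snd p)"

text \<open>
  \<open>v\<^sup>T \<otimes> I\<close> applied to a stacked vector; the index type \<open>1 \<times> 'n\<close> of the product
  is identified with \<open>'n\<close>.
\<close>

definition row_kronecker_id :: "real^'v::finite \<Rightarrow> real^('v \<times> 'n::finite) \<Rightarrow> real^'n" where
  "row_kronecker_id v x =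
     (\<chi> j. (kronecker (rowvector v :: real^'v^1) (mat 1 :: real^'n^'n) *v x) $ (1, j))"

section \<open>Transfer functions\<close>

definition transfer :: "real^'n^'n \<Rightarrow> real^'n \<Rightarrow> real^'l^'n \<Rightarrow> complex \<Rightarrow> complex^'l" where
  "transfer A B C s = transpose (cmatrix C) *v (matrix_inv (mat s - cmatrix A) *v cvector B)"

definition charpoly :: "real^'n^'n \<Rightarrow> real poly" where
  "charpoly A = det (mat [:0, 1:] - map_matrix (\<lambda>a. [:a:]) A)"

abbreviation cpoly :: "real poly \<Rightarrow> complex \<Rightarrow> complex" where
  "cpoly p \<equiv> poly (map_poly complex_of_real p)"

text \<open>
  \<open>p\<close> is the numerator of \<open>g\<^sup>T \<chi>(s)\<close> with respect to the denominator \<open>det (s I - A)\<close>.  Points where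
  the denominator vanishes are excluded because there \<^const>\<open>matrix_inv\<close> is unspecified; the
  remaining ones determine \<open>p\<close>.
\<close>

definition is_numerator ::
    "real^'n^'n \<Rightarrow> real^'n \<Rightarrow> real^'l^'n \<Rightarrow> real^'l \<Rightarrow> real poly \<Rightarrow> bool" where
  "is_numerator A B C g p \<longleftrightarrow>
     (\<forall>s. cpoly (charpoly A) s \<noteq> 0 \<longrightarrow>
        scalar_product (cvector g) (transfer A B C s) = cpoly p s / cpoly (charpoly A) s)"

definition hurwitz_poly :: "real poly \<Rightarrow> bool" where
  "hurwitz_poly p \<longleftrightarrow> (\<forall>z. cpoly p z = 0 \<longrightarrow> Re z < 0)"

definition hyper_minimum_phase ::
    "real^'n^'n \<Rightarrow> real^'n \<Rightarrow> real^'l^'n \<Rightarrow> real^'l \<Rightarrow> bool" where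
  "hyper_minimum_phase A B C g \<longleftrightarrow>
     (\<exists>p. is_numerator A B C g p \<and> hurwitz_poly p \<and>
          degree p = CARD('n) - 1 \<and> (\<forall>i \<le> degree p. coeff p i > 0))"

text \<open>
  The reciprocal is taken as a rational function, denominator over numerator, so that it is
  also correct at imaginary eigenvalues of \<open>A\<close>, which are poles of \<open>g\<^sup>T \<chi>\<close>.
\<close>

definition reciprocal_transfer ::
    "real^'n^'n \<Rightarrow> real^'n \<Rightarrow> real^'l^'n \<Rightarrow> real^'l \<Rightarrow> complex \<Rightarrow> complex" where
  "reciprocal_transfer A B C g s =
     cpoly (charpoly A) s / cpoly (THE p. is_numerator A B C g p) s"

text \<open>
  In the hyper-minimum-phase case the supremum is over a bounded set, the numerator having
  degree \<open>n - 1\<close>, positive leading coefficient and no imaginary roots.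
\<close>

definition kappa0 :: "real^'n^'n \<Rightarrow> real^'n \<Rightarrow> real^'l^'n \<Rightarrow> real^'l \<Rightarrow> real" where
  "kappa0 A B C g = (SUP \<omega>::real. Re (- reciprocal_transfer A B C g (\<i> * complex_of_real \<omega>)))"

end

theory Submission
  imports Defs "HOL-Complex_Analysis.Conformal_Mappings" "HOL-Real_Asymp.Real_Asymp"
    "HOL-Computational_Algebra.Fundamental_Theorem_Algebra"
begin

text \<open>
  Collect the agents as the rows of a matrix \<open>W\<close>, so that
  \<open>W' = W A\<^sup>T - k L W h B\<^sup>T\<close> with \<open>h = C g\<close>.  If \<open>L W = \<mu> W\<close>, every row evolves with the matrix
  \<open>A - k \<mu> B h\<^sup>T\<close>, whose characteristic polynomial is \<open>d + k \<mu> p\<close>, where \<open>d\<close> is that of \<open>A\<close> and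
  \<open>p\<close> is the numerator of \<open>g\<^sup>T \<chi>\<close>.  It has no root in the closed right half-plane, because there
  \<open>Re (- d/p) \<le> \<kappa>\<^sub>0 < k Re \<mu>\<close> by the maximum principle.  As \<open>L\<close> need not be diagonalizable, the
  eigenspaces are replaced by the linear factors of a polynomial annihilating \<open>L\<close>: if \<open>(L - \<mu>) W\<close>
  tends to \<open>0\<close> and \<open>\<mu> \<noteq> 0\<close>, it acts as a vanishing input and \<open>W\<close> tends to \<open>0\<close> as well.  This gives
  \<open>L W \<longlonglongrightarrow> 0\<close>.  Finally \<open>L + 1 v\<^sup>T\<close> is invertible, so \<open>W - 1 v\<^sup>T W\<close> tends to \<open>0\<close> too, and
  \<open>v\<^sup>T L = 0\<close> makes \<open>v\<^sup>T W\<close> a solution of \<open>c' = A c\<close>.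
\<close>

section \<open>Matrix algebra around the scalar matrices \<open>mat c\<close>\<close>

lemma mat_mult_component: "(mat c ** X) $ i $ j = c * X $ i $ j"
  for X :: "'a::semiring_1^'k^'m"
  by (simp add: matrix_matrix_mult_def mat_def if_distrib[of "\<lambda>x. x * _"] cong: if_cong)

lemma mult_mat_component: "(X ** mat c) $ i $ j = X $ i $ j * c"
  for X :: "'a::semiring_1^'k^'m"
  by (simp add: matrix_matrix_mult_def mat_def if_distrib[of "\<lambda>x. _ * x"] cong: if_cong)

lemma mat_mult_commute: "mat c ** X = X ** mat c"
  for X :: "'a::comm_semiring_1^'k^'m"
  by (simp add: vec_eq_iff mat_mult_component mult_mat_component mult.commute)

lemma mat_mult_left_commute: "M ** (mat c ** X) = mat c ** (M ** X)"
  for X :: "'a::comm_semiring_1^'k^'m" and M :: "'a^'m^'n"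
  unfolding matrix_mul_assoc by (simp only: mat_mult_commute[of c M])

lemma mat_mult_vector: "mat c *v w = c *s w"
  for w :: "'a::semiring_1^'m"
  by (simp add: vec_eq_iff matrix_vector_mult_def mat_def if_distrib[of "\<lambda>x. x * _"] cong: if_cong)

lemma mat_0: "mat 0 = 0"
  by (simp add: mat_def vec_eq_iff)

lemma matrix_mult_0_left: "0 ** X = 0"
  for X :: "'a::semiring_1^'k^'m"
  by (simp add: vec_eq_iff matrix_matrix_mult_def)

lemma matrix_mult_0_right: "X ** 0 = 0"
  for X :: "'a::semiring_1^'k^'m"
  by (simp add: vec_eq_iff matrix_matrix_mult_def)

lemma matrix_add_rdistrib: "(X + Y) ** Z = X ** Z + Y ** Z"
  for X Y :: "'a::semiring_1^'k^'m"
  by (simp add: vec_eq_iff matrix_matrix_mult_def sum.distrib algebra_simps)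

lemma matrix_diff_rdistrib: "(X - Y) ** Z = X ** Z - Y ** Z"
  for X Y :: "'a::ring_1^'k^'m"
  by (simp add: vec_eq_iff matrix_matrix_mult_def sum_subtractf algebra_simps)

lemma matrix_diff_ldistrib: "Z ** (X - Y) = Z ** X - Z ** Y"
  for X Y :: "'a::ring_1^'k^'m"
  by (simp add: vec_eq_iff matrix_matrix_mult_def sum_subtractf algebra_simps)

lemma bounded_linear_matrix_mult_left:
  fixes M :: "'a::{euclidean_space,real_algebra_1}^'m^'n"
  shows "bounded_linear (\<lambda>X :: 'a^'k^'m. M ** X)"
  unfolding linear_conv_bounded_linear[symmetric]
  by (rule linearI)
     (simp_all add: vec_eq_iff matrix_matrix_mult_def sum.distrib scaleR_sum_right algebra_simps)

lemma bounded_linear_transpose: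
  "bounded_linear (transpose :: 'a::euclidean_space^'m^'n \<Rightarrow> _)"
  unfolding linear_conv_bounded_linear[symmetric]
  by (rule linearI) (simp_all add: vec_eq_iff transpose_def)

lemma tendsto_matrix_mult_zero:
  fixes M :: "'a::{euclidean_space,real_algebra_1}^'m^'n" and F :: "'b \<Rightarrow> 'a^'k^'m"
  assumes "(F \<longlongrightarrow> 0) net"
  shows "((\<lambda>t. M ** F t) \<longlongrightarrow> 0) net"
  using bounded_linear.tendsto_zero[OF bounded_linear_matrix_mult_left assms] .

subsection \<open>Polynomials of a matrix\<close>

text \<open>Horner's scheme, folded in the same way as \<open>poly\<close>, with each scalar
  \<open>a\<close> entering as \<open>mat a\<close>.\<close>

definition matrix_poly :: "'a::comm_ring_1 poly \<Rightarrow> 'a^'m^'m \<Rightarrow> 'a^'m^'m" where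
  "matrix_poly p M = fold_coeffs (\<lambda>a R. mat a + M ** R) p 0"

lemma matrix_poly_0 [simp]: "matrix_poly 0 M = 0"
  by (simp add: matrix_poly_def)

lemma matrix_poly_pCons: "matrix_poly (pCons a p) M = mat a + M ** matrix_poly p M"
  by (cases "p = 0 \<and> a = 0") (auto simp: matrix_poly_def mat_0 matrix_mult_0_right)

lemma mat_add: "mat (a + b) = mat a + (mat b :: 'a::comm_ring_1^'m^'m)"
  by (simp add: mat_def vec_eq_iff)

lemma matrix_poly_add: "matrix_poly (p + q) M = matrix_poly p M + matrix_poly q M"
  by (induction p q rule: poly_induct2)
     (simp_all add: matrix_poly_pCons matrix_add_ldistrib mat_add algebra_simps)

lemma matrix_poly_sum: "matrix_poly (sum f S) M = (\<Sum>x\<in>S. matrix_poly (f x) M)"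
  by (induction S rule: infinite_finite_induct) (simp_all add: matrix_poly_add)

lemma matrix_poly_smult: "matrix_poly (smult c p) M = mat c ** matrix_poly p M"
proof (induction p)
  case 0
  then show ?case by (simp add: matrix_mult_0_right)
next
  case (pCons a p)
  have "mat (c * a) = mat c ** (mat a :: 'a^'b^'b)"
    by (simp add: vec_eq_iff mat_mult_component) (simp add: mat_def)
  then show ?case
    using pCons by (simp add: matrix_poly_pCons matrix_add_ldistrib mat_mult_left_commute)
qed

lemma matrix_poly_mult: "matrix_poly (p * q) M = matrix_poly p M ** matrix_poly q M"
proof (induction p)
  case 0
  then show ?case by (simp add: matrix_mult_0_left)
next
  case (pCons a p)
  then show ?case
    by (simp add: matrix_poly_add matrix_poly_smult matrix_poly_pCons matrix_add_rdistrib
        matrix_mul_assoc mat_0)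
qed

lemma matrix_poly_monom: "matrix_poly (monom c k) M = mat c ** matrix_power M k"
proof (induction k)
  case 0
  then show ?case by (simp add: monom_0 matrix_poly_pCons matrix_mult_0_right)
next
  case (Suc k)
  then show ?case by (simp add: monom_Suc matrix_poly_pCons mat_0 mat_mult_left_commute)
qed

lemma matrix_poly_eigenvector:
  assumes "M *v w = z *s w"
  shows "matrix_poly p M *v w = poly p z *s w"
proof (induction p)
  case (pCons a p)
  have "M *v (poly p z *s w) = poly p z *s (M *v w)"
    by (simp add: matrix_vector_mult_def vec_eq_iff sum_distrib_left mult_ac)
  then have "M *v (poly p z *s w) = (z * poly p z) *s w"
    by (simp add: assms mult.commute)
  then show ?case
    by (simp add: matrix_poly_pCons matrix_vector_mult_add_rdistrib mat_mult_vector
        matrix_vector_mul_assoc[symmetric] pCons.IH vector_sadd_rdistrib)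
qed (simp add: vec_eq_iff)

text \<open>The powers of \<open>M\<close> lie in a finite-dimensional real space: either two of
  them coincide, or they form an infinite and hence dependent set. The cases are separated because
  \<open>dependent\<close> speaks of sets, in which repeated powers would merge.\<close>

lemma annihilating_poly_exists:
  fixes M :: "complex^'m^'m"
  obtains p where "p \<noteq> 0" "matrix_poly p M = 0"
proof (cases "inj (matrix_power M)")
  case False
  then obtain i j where ij: "i \<noteq> j" "matrix_power M i = matrix_power M j"
    by (auto simp: inj_def)
  show ?thesis
  proof
    have "coeff (monom 1 i + monom (-1) j) i = (1::complex)"
      using ij(1) by (auto simp: coeff_monom)
    then show "monom (1::complex) i + monom (-1) j \<noteq> 0"
      by (metis coeff_0 zero_neq_one)
    show "matrix_poly (monom 1 i + monom (-1) j) M = 0"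
      using ij by (simp add: matrix_poly_add matrix_poly_monom vec_eq_iff mat_mult_component)
  qed
next
  case True
  then have "infinite (range (matrix_power M))"
    using finite_imageD infinite_UNIV_nat by blast
  then have "dependent (range (matrix_power M))"
    using independent_imp_finite by blast
  then obtain S u where S: "finite S" "S \<subseteq> range (matrix_power M)"
      "(\<Sum>v\<in>S. u v *\<^sub>R v) = 0" "\<exists>v\<in>S. u v \<noteq> 0"
    unfolding dependent_explicit by blast
  define I where "I = {i. matrix_power M i \<in> S}"
  have S_eq: "S = matrix_power M ` I"
    using S(2) by (auto simp: I_def)
  have inj: "inj_on (matrix_power M) I"
    using True inj_on_subset by blast
  have fin: "finite I"
    using S(1) S_eq inj finite_imageD by blast
  define p where "p = (\<Sum>i\<in>I. monom (complex_of_real (u (matrix_power M i))) i)"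
  have coeff_p: "coeff p i = complex_of_real (u (matrix_power M i))" if "i \<in> I" for i
    using that fin by (simp add: p_def coeff_sum)
  show ?thesis
  proof
    show "p \<noteq> 0"
      using S(4) S_eq coeff_p by (metis coeff_0 imageE of_real_eq_0_iff)
    have scale: "mat (complex_of_real c) ** X = c *\<^sub>R X" for c and X :: "complex^'m^'m"
      unfolding vec_eq_iff mat_mult_component vector_scaleR_component
      by (simp add: scaleR_conv_of_real)
    have "matrix_poly p M = (\<Sum>i\<in>I. u (matrix_power M i) *\<^sub>R matrix_power M i)"
      by (simp add: p_def matrix_poly_sum matrix_poly_monom scale)
    also have "\<dots> = (\<Sum>v\<in>S. u v *\<^sub>R v)"
      unfolding S_eq by (subst sum.reindex[OF inj]) simp
    finally show "matrix_poly p M = 0" using S(3) by simp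
  qed
qed

text \<open>Unlike \<open>complex_eigenvalue\<close> this allows genuinely complex matrices, such as
  the closed loop with a gain \<open>k * \<mu>\<close> that is not real.\<close>

definition eigenvalue :: "complex^'m^'m \<Rightarrow> complex \<Rightarrow> bool" where
  "eigenvalue M z \<longleftrightarrow> (\<exists>w. w \<noteq> 0 \<and> M *v w = z *s w)"

text \<open>Eigenvalues are roots of any annihilating polynomial. Finiteness makes the
  \<open>Min\<close> in \<open>r_min\<close> a true minimum.\<close>

lemma finite_eigenvalues: "finite {z. eigenvalue M z}"
proof -
  obtain p where p: "p \<noteq> 0" "matrix_poly p M = 0"
    using annihilating_poly_exists .
  have "poly p z = 0" if z: "eigenvalue M z" for z
  proof -
    obtain w where w: "w \<noteq> 0" "M *v w = z *s w"
      using z by (auto simp: eigenvalue_def)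
    have "poly p z *s w = 0"
      using matrix_poly_eigenvector[OF w(2), of p] p by simp
    with w show ?thesis by (auto simp: vec_eq_iff)
  qed
  then show ?thesis
    using finite_subset[OF _ poly_roots_finite[OF p(1)]] by blast
qed

lemma not_eigenvalue_left_inverse:
  assumes "\<not> eigenvalue M z"
  obtains R where "R ** (M - mat z) = mat 1"
proof -
  have "w = 0" if "(M - mat z) *v w = 0" for w
    using that assms
    by (auto simp: eigenvalue_def matrix_vector_mult_diff_rdistrib mat_mult_vector)
  then show ?thesis
    using matrix_left_invertible_ker[of "M - mat z"] that by blast
qed

text \<open>
  A substitute for the decomposition into generalized eigenspaces: a polynomial annihilating \<open>M\<close>
  is a product of factors \<open>M - \<mu>\<close>, which are cancelled one at a time.
\<close>

lemma tendsto_zero_by_eigenvalues: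
  fixes M :: "complex^'m^'m" and S :: "(real \<Rightarrow> complex^'k^'m) set"
  assumes closed: "\<And>F \<mu>. F \<in> S \<Longrightarrow> (\<lambda>t. (M - mat \<mu>) ** F t) \<in> S"
    and step: "\<And>F \<mu>. F \<in> S \<Longrightarrow> eigenvalue M \<mu> \<Longrightarrow>
      ((\<lambda>t. (M - mat \<mu>) ** F t) \<longlongrightarrow> 0) at_top \<Longrightarrow> (F \<longlongrightarrow> 0) at_top"
    and "F \<in> S"
  shows "(F \<longlongrightarrow> 0) at_top"
proof -
  \<comment> \<open>Induction on the degree: one linear factor at a time is moved from the
    polynomial to the function, which stays in \<open>S\<close>.\<close>
  have "(F \<longlongrightarrow> 0) at_top"
    if "p \<noteq> 0" "F \<in> S" "((\<lambda>t. matrix_poly p M ** F t) \<longlongrightarrow> 0) at_top" for p F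
    using that
  proof (induction "degree p" arbitrary: p F rule: less_induct)
    case less
    show ?case
    proof (cases "degree p = 0")
      case True
      then obtain c where c: "p = [:c:]" "c \<noteq> 0"
        using less.prems(1) by (metis degree_eq_zeroE pCons_0_0)
      have "mat (1 / c) ** (matrix_poly p M ** F t) = F t" for t
        using c by (simp add: matrix_poly_pCons vec_eq_iff mat_mult_component matrix_mult_0_right)
      then show ?thesis
        using tendsto_matrix_mult_zero[OF less.prems(3), of "mat (1 / c)"] by simp
    next
      case False
      then obtain \<mu> where "poly p \<mu> = 0"
        using fundamental_theorem_of_algebra by (auto simp: constant_degree)
      then obtain q where q: "p = q * [:-\<mu>, 1:]"
        by (metis dvdE mult.commute poly_eq_0_iff_dvd)
      have "q \<noteq> 0" "degree q < degree p"
        using less.prems(1) by (auto simp: q degree_mult_eq simp del: mult_pCons_right)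
      define F' where "F' = (\<lambda>t. (M - mat \<mu>) ** F t)"
      have "matrix_poly [:-\<mu>, 1:] M = M - mat \<mu>"
        by (simp add: matrix_poly_pCons matrix_mult_0_right)
           (simp add: vec_eq_iff mat_def)
      then have "matrix_poly p M ** F t = matrix_poly q M ** F' t" for t
        by (simp add: q matrix_poly_mult F'_def matrix_mul_assoc del: mult_pCons_right)
      moreover have "F' \<in> S"
        using closed less.prems(2) by (simp add: F'_def)
      ultimately have F': "(F' \<longlongrightarrow> 0) at_top"
        using less.hyps[OF \<open>degree q < degree p\<close> \<open>q \<noteq> 0\<close>] less.prems(3) by simp
      show ?thesis
      proof (cases "eigenvalue M \<mu>")
        case True
        then show ?thesis using step[OF less.prems(2)] F' by (simp add: F'_def)
      next
        case False
        then obtain R where R: "R ** (M - mat \<mu>) = mat 1"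
          using not_eigenvalue_left_inverse by blast
        have "R ** F' t = F t" for t
          by (simp add: F'_def matrix_mul_assoc R)
        then show ?thesis
          using tendsto_matrix_mult_zero[OF F', of R] by simp
      qed
    qed
  qed
  moreover obtain p where "p \<noteq> 0" "matrix_poly p M = 0"
    using annihilating_poly_exists .
  ultimately show ?thesis
    using \<open>F \<in> S\<close> by (simp add: matrix_mult_0_left)
qed

subsection \<open>Stability of linear systems with vanishing input\<close>

text \<open>Multiplied by the integrating factor \<open>exp (- \<mu> t)\<close>, \<open>w\<close>
  has the derivative \<open>exp (- \<mu> t) v\<close>. Once \<open>v\<close> is small, this is
  dominated by the derivative of a small multiple of \<open>exp (\<sigma> t)\<close> with
  \<open>\<sigma> = - Re \<mu>\<close>, and a mean value inequality replaces variation of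
  constants.\<close>

lemma scalar_ode_tendsto_zero:
  fixes w v :: "real \<Rightarrow> complex"
  assumes ode: "\<And>t. t \<ge> 0 \<Longrightarrow> (w has_vector_derivative (\<mu> * w t + v t)) (at t within {0..})"
    and v: "(v \<longlongrightarrow> 0) at_top" and \<mu>: "Re \<mu> < 0"
  shows "(w \<longlongrightarrow> 0) at_top"
proof (rule tendstoI)
  fix e :: real assume "e > 0"
  define \<sigma> where "\<sigma> = - Re \<mu>"
  have \<sigma>: "\<sigma> > 0" using \<mu> by (simp add: \<sigma>_def)
  define \<delta> where "\<delta> = e / 2"
  have \<delta>: "\<delta> > 0" using \<open>e > 0\<close> by (simp add: \<delta>_def)
  \<comment> \<open>The factor \<open>\<sigma>\<close> is absorbed when
    \<open>\<delta> * \<sigma> * exp (\<sigma> * s)\<close> is integrated, so that the input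
    contributes at most \<open>\<delta>\<close>, half of \<open>e\<close>.\<close>
  have "\<forall>\<^sub>F t in at_top. norm (v t) < \<delta> * \<sigma>"
    using tendstoD[OF v, of "\<delta> * \<sigma>"] \<sigma> \<delta> by simp
  then obtain T0 where T0: "\<And>t. t \<ge> T0 \<Longrightarrow> norm (v t) < \<delta> * \<sigma>"
    by (auto simp: eventually_at_top_linorder)
  define T where "T = max T0 0"
  have T: "T \<ge> 0" "\<And>t. t \<ge> T \<Longrightarrow> norm (v t) < \<delta> * \<sigma>"
    using T0 by (auto simp: T_def)
  define f where "f = (\<lambda>t. exp (t *\<^sub>R (- \<mu>)) * w t)"
  have f': "(f has_vector_derivative exp (t *\<^sub>R (- \<mu>)) * v t) (at t within {0..})" if "t \<ge> 0" for t
    unfolding f_def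
    by (rule has_vector_derivative_eq_rhs,
        rule has_vector_derivative_mult[OF exp_scaleR_has_vector_derivative_right ode[OF that]])
       (simp add: algebra_simps)
  have bound: "norm (w t) \<le> exp (- \<sigma> * (t - T)) * norm (w T) + \<delta>" if t: "t > T" for t
  proof -
    have "norm (f t - f T) \<le> \<delta> * exp (\<sigma> * t) - \<delta> * exp (\<sigma> * T)"
    proof (rule differentiable_bound_general[OF t,
          where f' = "\<lambda>s. exp (s *\<^sub>R (- \<mu>)) * v s" and \<phi>' = "\<lambda>s. \<delta> * \<sigma> * exp (\<sigma> * s)"])
      show "continuous_on {T..t} f"
      proof (rule continuous_on_subset)
        show "continuous_on {0..} f"
          unfolding continuous_on_eq_continuous_within
          using f' by (auto intro: has_vector_derivative_continuous)
      qed (use T in auto)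
      show "continuous_on {T..t} (\<lambda>s. \<delta> * exp (\<sigma> * s))"
        by (intro continuous_intros)
      fix s assume s: "T < s" "s < t"
      \<comment> \<open>As \<open>T \<ge> 0\<close>, the point \<open>s\<close> is interior and the
        one-sided derivative is a full one.\<close>
      have "at s within {0..} = at s"
        using s T by (intro at_within_interior) (auto simp: interior_real_atLeast)
      then show "(f has_vector_derivative exp (s *\<^sub>R (- \<mu>)) * v s) (at s)"
        using f'[of s] s T by simp
      show "((\<lambda>s. \<delta> * exp (\<sigma> * s)) has_vector_derivative \<delta> * \<sigma> * exp (\<sigma> * s)) (at s)"
        unfolding has_real_derivative_iff_has_vector_derivative[symmetric]
        by (auto intro!: derivative_eq_intros)
      have "norm (exp (s *\<^sub>R (- \<mu>)) * v s) = exp (\<sigma> * s) * norm (v s)"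
        by (simp add: norm_mult \<sigma>_def norm_exp_eq_Re algebra_simps)
      also have "\<dots> \<le> exp (\<sigma> * s) * (\<delta> * \<sigma>)"
        using T(2)[of s] s by (intro mult_left_mono) auto
      finally show "norm (exp (s *\<^sub>R (- \<mu>)) * v s) \<le> \<delta> * \<sigma> * exp (\<sigma> * s)"
        by (simp add: mult_ac)
    qed
    moreover have nf: "norm (f s) = exp (\<sigma> * s) * norm (w s)" for s
      by (simp add: f_def norm_mult \<sigma>_def norm_exp_eq_Re algebra_simps)
    ultimately have "exp (\<sigma> * t) * norm (w t) \<le> exp (\<sigma> * T) * norm (w T) + \<delta> * exp (\<sigma> * t)"
      using norm_triangle_ineq2[of "f t" "f T"] \<delta>
      by (smt (verit) exp_gt_zero mult_pos_pos)
    then have "exp (- \<sigma> * t) * (exp (\<sigma> * t) * norm (w t))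
        \<le> exp (- \<sigma> * t) * (exp (\<sigma> * T) * norm (w T) + \<delta> * exp (\<sigma> * t))"
      by (intro mult_left_mono) auto
    then show ?thesis
      by (simp add: exp_minus exp_diff field_simps)
  qed
  have "((\<lambda>t. exp (- \<sigma> * (t - T)) * norm (w T)) \<longlongrightarrow> 0) at_top"
    using \<sigma> by real_asymp
  then have "\<forall>\<^sub>F t in at_top. exp (- \<sigma> * (t - T)) * norm (w T) < \<delta>"
    using \<delta> by (simp add: order_tendstoD)
  then show "\<forall>\<^sub>F t in at_top. dist (w t) 0 < e"
    using eventually_gt_at_top[of T]
  proof eventually_elim
    case (elim t)
    then show ?case using bound[of t] by (simp add: \<delta>_def)
  qed
qed

text \<open>\<open>S\<close> consists of all solutions driven by some vanishing input. It is closed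
  under \<open>M - \<mu>\<close>, which commutes with \<open>M\<close>. If
  \<open>(M - \<mu>) F\<close> tends to \<open>0\<close>, then
  \<open>F' = \<mu> F + ((M - \<mu>) F + V)\<close> splits into one scalar equation with vanishing
  input for each entry.\<close>

lemma matrix_ode_tendsto_zero:
  fixes M :: "complex^'m^'m" and G V :: "real \<Rightarrow> complex^'k^'m"
  assumes stable: "\<And>\<mu>. eigenvalue M \<mu> \<Longrightarrow> Re \<mu> < 0"
    and ode: "\<And>t. t \<ge> 0 \<Longrightarrow> (G has_vector_derivative (M ** G t + V t)) (at t within {0..})"
    and V: "(V \<longlongrightarrow> 0) at_top"
  shows "(G \<longlongrightarrow> 0) at_top"
proof (rule tendsto_zero_by_eigenvalues[where M = M and
      S = "{G. \<exists>V. (V \<longlongrightarrow> 0) at_top \<and>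
        (\<forall>t\<ge>0. (G has_vector_derivative (M ** G t + V t)) (at t within {0..}))}"])
  show "G \<in> {G. \<exists>V. (V \<longlongrightarrow> 0) at_top \<and>
        (\<forall>t\<ge>0. (G has_vector_derivative (M ** G t + V t)) (at t within {0..}))}"
    using ode V by blast
next
  fix F :: "real \<Rightarrow> complex^'k^'m" and \<mu>
  assume "F \<in> {G. \<exists>V. (V \<longlongrightarrow> 0) at_top \<and>
        (\<forall>t\<ge>0. (G has_vector_derivative (M ** G t + V t)) (at t within {0..}))}"
  then obtain V where V: "(V \<longlongrightarrow> 0) at_top"
    and F: "\<And>t. t \<ge> 0 \<Longrightarrow> (F has_vector_derivative (M ** F t + V t)) (at t within {0..})"
    by auto
  have comm: "(M - mat \<mu>) ** (M ** X) = M ** ((M - mat \<mu>) ** X)" for X :: "complex^'k^'m"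
    by (simp add: matrix_diff_ldistrib matrix_diff_rdistrib mat_mult_left_commute)
  have "((\<lambda>t. (M - mat \<mu>) ** F t) has_vector_derivative
      (M ** ((M - mat \<mu>) ** F t) + (M - mat \<mu>) ** V t)) (at t within {0..})" if "t \<ge> 0" for t
    using bounded_linear.has_vector_derivative[OF bounded_linear_matrix_mult_left[of "M - mat \<mu>"] F[OF that]]
    by (simp add: matrix_add_ldistrib comm)
  then show "(\<lambda>t. (M - mat \<mu>) ** F t) \<in> {G. \<exists>V. (V \<longlongrightarrow> 0) at_top \<and>
        (\<forall>t\<ge>0. (G has_vector_derivative (M ** G t + V t)) (at t within {0..}))}"
    using tendsto_matrix_mult_zero[OF V, of "M - mat \<mu>"]
    by (intro CollectI exI[of _ "\<lambda>t. (M - mat \<mu>) ** V t"]) auto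
  assume ev: "eigenvalue M \<mu>" and lim: "((\<lambda>t. (M - mat \<mu>) ** F t) \<longlongrightarrow> 0) at_top"
  show "(F \<longlongrightarrow> 0) at_top"
  proof (intro vec_tendstoI)
    fix i j
    have lim': "((\<lambda>t. (M - mat \<mu>) ** F t + V t) \<longlongrightarrow> 0) at_top"
      using tendsto_add[OF lim V] by simp
    have "((\<lambda>t. F t $ i $ j) has_vector_derivative
        (\<mu> * F t $ i $ j + ((M - mat \<mu>) ** F t + V t) $ i $ j)) (at t within {0..})" if "t \<ge> 0" for t
    proof -
      have "((\<lambda>t. F t $ i $ j) has_vector_derivative ((M ** F t + V t) $ i $ j)) (at t within {0..})"
        by (intro bounded_linear.has_vector_derivative[OF bounded_linear_vec_nth] F that)
      then show ?thesis
        by (simp add: matrix_diff_rdistrib mat_mult_component)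
    qed
    moreover have "((\<lambda>t. ((M - mat \<mu>) ** F t + V t) $ i $ j) \<longlongrightarrow> 0) at_top"
      using tendsto_vec_nth[OF tendsto_vec_nth[OF lim'], of i j] by simp
    ultimately have "((\<lambda>t. F t $ i $ j) \<longlongrightarrow> 0) at_top"
      using stable[OF ev] by (rule scalar_ode_tendsto_zero)
    then show "((\<lambda>t. F t $ i $ j) \<longlongrightarrow> 0 $ i $ j) at_top"
      by simp
  qed
qed

subsection \<open>Laplace matrices\<close>

lemma finite_type_max:
  fixes f :: "'v::finite \<Rightarrow> 'a::linorder"
  obtains i where "\<And>j. f j \<le> f i"
proof -
  have "Max (range f) \<in> range f"
    by (rule Max_in) auto
  then obtain i where "f i = Max (range f)"
    by (metis rangeE)
  then have "f j \<le> f i" for j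
    by simp
  then show ?thesis using that by blast
qed

lemma laplace_component: "(laplace_matrix E *v w) $ i = (\<Sum>j\<in>neighbours E i. w $ i - w $ j)"
proof -
  have "(laplace_matrix E *v w) $ i = (\<Sum>j\<in>UNIV. if (i, j) \<in> E then 1 else 0) * w $ i
      - (\<Sum>j\<in>UNIV. (if (i, j) \<in> E then 1 else 0) * w $ j)"
    by (simp add: laplace_matrix_def matrix_vector_mult_diff_rdistrib)
       (simp add: diag_def adjacency_matrix_def
        matrix_vector_mult_def if_distrib[of "\<lambda>x. x * _"] cong: if_cong)
  also have "\<dots> = (\<Sum>j\<in>UNIV. if (i, j) \<in> E then w $ i - w $ j else 0)"
    by (simp add: sum_distrib_right sum_subtractf[symmetric] if_distrib[of "\<lambda>x. x * _"] cong: if_cong)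
       (auto intro: sum.cong)
  also have "\<dots> = (\<Sum>j\<in>neighbours E i. w $ i - w $ j)"
    by (simp add: neighbours_def sum.If_cases)
  finally show ?thesis .
qed

lemma claplace_component:
  "(cmatrix (laplace_matrix E) *v w) $ i = (\<Sum>j\<in>neighbours E i. w $ i - w $ j)"
proof -
  have mv: "(cmatrix M *v w) $ i = Complex ((M *v (\<chi> i. Re (w $ i))) $ i) ((M *v (\<chi> i. Im (w $ i))) $ i)"
    for M :: "real^'a^'a"
    by (simp add: complex_eq_iff matrix_vector_mult_def)
  show ?thesis
    unfolding mv laplace_component by (simp add: complex_eq_iff)
qed

lemma laplace_one: "laplace_matrix E *v 1 = 0"
  by (simp add: vec_eq_iff laplace_component)

text \<open>Minimum principle: at a minimal entry of \<open>w\<close> the entry of \<open>L w\<close> is nonpositive.\<close>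

lemma one_not_in_range_laplace: "laplace_matrix E *v w \<noteq> 1"
proof
  assume eq: "laplace_matrix E *v w = 1"
  obtain i where "\<And>j. - w $ j \<le> - w $ i"
    using finite_type_max[of "\<lambda>j. - w $ j"] by blast
  then have "(laplace_matrix E *v w) $ i \<le> 0"
    unfolding laplace_component by (intro sum_nonpos) simp
  with eq show False by simp
qed

text \<open>At a maximal entry the differences to the parents are nonnegative and sum to zero, so
  the parents are maximal too. A path carries the maximum to the root.\<close>

lemma max_at_root:
  assumes reach: "\<And>a. (a, r) \<in> E\<^sup>*" and ker: "laplace_matrix E *v w = 0"
  shows "w $ a \<le> w $ r"
proof -
  obtain i where max: "\<And>j. w $ j \<le> w $ i"
    using finite_type_max[of "($) w"] by blast
  have "w $ r = w $ i"
    using reach[of i]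
  proof (induction rule: rtrancl_induct)
    case (step b c)
    have "(\<Sum>j\<in>neighbours E b. w $ b - w $ j) = 0"
      using ker laplace_component[of E w b] by simp
    then have "\<forall>j\<in>neighbours E b. w $ b - w $ j = 0"
      using max step.IH by (subst (asm) sum_nonneg_eq_0_iff) auto
    then show ?case using step by (simp add: neighbours_def)
  qed simp
  then show ?thesis using max by simp
qed

lemma spanning_tree_root:
  assumes "has_directed_spanning_tree E"
  obtains r where "\<And>a. (a, r) \<in> E\<^sup>*"
proof -
  obtain T r where T: "directed_spanning_tree E T r"
    using assms by (auto simp: has_directed_spanning_tree_def)
  then have "(a, r) \<in> E\<^sup>*" for a
    using rtrancl_mono[of T E] by (auto simp: directed_spanning_tree_def)
  then show ?thesis using that by blast
qed

lemma laplace_kernel: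
  assumes "has_directed_spanning_tree E" "laplace_matrix E *v w = 0"
  shows "w $ a = w $ b"
proof -
  obtain r where r: "\<And>a. (a, r) \<in> E\<^sup>*"
    using spanning_tree_root[OF assms(1)] by blast
  have "laplace_matrix E *v (- w) = 0"
    using assms(2) by (metis matrix_vector_mult_diff_distrib matrix_vector_mult_0_right diff_0 minus_zero)
  then have "w $ c = w $ r" for c
    using max_at_root[OF r assms(2), of c] max_at_root[OF r, of "- w" c] by simp
  then show ?thesis by metis
qed

text \<open>Gershgorin discs: each of them touches the imaginary axis only at \<open>0\<close>.\<close>

lemma laplace_eigenvalue_Re_pos:
  assumes "eigenvalue (cmatrix (laplace_matrix E)) z" "z \<noteq> 0"
  shows "Re z > 0"
proof -
  obtain w where w: "w \<noteq> 0" and ev: "cmatrix (laplace_matrix E) *v w = z *s w"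
    using assms unfolding eigenvalue_def by blast
  obtain i where max: "\<And>j. cmod (w $ j) \<le> cmod (w $ i)"
    using finite_type_max[of "\<lambda>i. cmod (w $ i)"] by blast
  have wi: "w $ i \<noteq> 0"
    using w max by (metis norm_le_zero_iff norm_zero vec_eq_iff zero_index)
  define d where "d = real (card (neighbours E i))"
  have "z * w $ i = (\<Sum>j\<in>neighbours E i. w $ i - w $ j)"
    using ev claplace_component[of E w i] by simp
  then have "(d - z) * w $ i = (\<Sum>j\<in>neighbours E i. w $ j)"
    by (simp add: sum_subtractf d_def algebra_simps)
  then have "cmod (d - z) * cmod (w $ i) \<le> d * cmod (w $ i)"
    using sum_norm_bound[of "neighbours E i" "\<lambda>j. w $ j" "cmod (w $ i)"] max
    by (simp add: norm_mult[symmetric] d_def)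
  then have "cmod (d - z) \<le> d" using wi by simp
  then have "(cmod (d - z))\<^sup>2 \<le> d\<^sup>2" by (intro power_mono) auto
  then have "(d - Re z)\<^sup>2 + (Im z)\<^sup>2 \<le> d\<^sup>2" by (simp add: cmod_power2)
  then have "(Re z)\<^sup>2 + (Im z)\<^sup>2 \<le> 2 * d * Re z" by (simp add: power2_eq_square algebra_simps)
  moreover have "(Re z)\<^sup>2 + (Im z)\<^sup>2 > 0"
    using \<open>z \<noteq> 0\<close> by (simp add: complex_eq_iff sum_power2_gt_zero_iff)
  ultimately have "d * Re z > 0" by linarith
  moreover have "d \<ge> 0" by (simp add: d_def)
  ultimately show ?thesis by (simp add: zero_less_mult_iff)
qed

text \<open>\<open>R\<close> is the inverse of \<open>L + 1 v\<^sup>T\<close>. Its first property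
  says that \<open>L\<close> is injective on its own range; the second splits \<open>w\<close> into
  a part controlled by \<open>L w\<close> and a part in which all agents agree.\<close>

lemma left_null_vec_laplace:
  fixes E :: "('v::finite \<times> 'v) set"
  assumes span: "has_directed_spanning_tree E"
  defines "L \<equiv> laplace_matrix E" and "v \<equiv> left_null_vec (laplace_matrix E)"
  shows "v v* L = 0"
    and "\<exists>R. R ** L ** L = L \<and> (\<forall>w. w = R *v (L *v w) + (v \<bullet> w) *\<^sub>R 1)"
proof -
  have sp: "scalar_product a b = a \<bullet> b" for a b :: "real^'v"
    by (simp add: scalar_product_def inner_vec_def)
  define S where "S = range ((*v) L)"
  have S: "subspace S"
    unfolding S_def by (intro linear_subspace_image) auto
  \<comment> \<open>The component \<open>n\<close> of \<open>1\<close> orthogonal to the range of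
    \<open>L\<close> is a left null vector. It is nonzero because \<open>1\<close> is not in that
    range, and \<open>n \<bullet> 1 = n \<bullet> n\<close> permits normalization.\<close>
  obtain y n where yn: "y \<in> span S" "\<And>w. w \<in> span S \<Longrightarrow> orthogonal n w" "1 = y + n"
    using orthogonal_subspace_decomp_exists[of S 1] by metis
  have "span S = S" using S span_eq_iff by blast
  have "n \<noteq> 0"
  proof
    assume "n = 0"
    then have "1 \<in> S" using yn \<open>span S = S\<close> by simp
    then show False
      using one_not_in_range_laplace[of E] unfolding S_def L_def by (metis imageE)
  qed
  have "n \<bullet> y = 0" using yn by (simp add: orthogonal_def)
  then have n1: "n \<bullet> 1 = n \<bullet> n" using yn(3) by (metis add_0 inner_add_right)
  then have n1': "n \<bullet> 1 \<noteq> 0" using \<open>n \<noteq> 0\<close> by simp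
  have "(n v* L) \<bullet> w = 0" for w
    using yn(2)[of "L *v w"] by (simp add: dot_lmul_matrix S_def orthogonal_def span_base)
  then have nL: "n v* L = 0" by (metis inner_eq_zero_iff)
  define p where "p = (1 / (n \<bullet> 1)) *\<^sub>R n"
  have p: "p v* L = 0" "p \<bullet> 1 = 1"
    using nL n1' by (simp_all add: p_def scaleR_vector_matrix_assoc)
  \<comment> \<open>Adding \<open>1 p\<^sup>T\<close> removes the kernel: \<open>p\<close>
    annihilates the range of \<open>L\<close>, so \<open>Q w = 0\<close> forces
    \<open>p \<bullet> w = 0\<close> and then \<open>L w = 0\<close>, which makes \<open>w\<close>
    constant.\<close>
  define Q where "Q = L + (\<chi> i j. p $ j)"
  have Q: "Q *v w = L *v w + (p \<bullet> w) *\<^sub>R 1" for w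
    by (simp add: Q_def matrix_vector_mult_add_rdistrib)
       (simp add: vec_eq_iff matrix_vector_mult_def inner_vec_def)
  have pL: "p \<bullet> (L *v w) = 0" for w
    using p(1) by (metis dot_lmul_matrix inner_zero_left)
  have "w = 0" if "Q *v w = 0" for w
  proof -
    have "p \<bullet> w = p \<bullet> (Q *v w)"
      by (simp add: Q inner_add_right pL p)
    then have pw: "p \<bullet> w = 0" using that by simp
    then have "L *v w = 0" using that by (simp add: Q)
    then have const: "w $ a = w $ b" for a b
      using laplace_kernel[OF span] by (simp add: L_def)
    \<comment> \<open>All entries agree, so any index will do.\<close>
    define c where "c = w $ undefined"
    have "w = c *\<^sub>R 1"
      using const by (simp add: vec_eq_iff c_def)
    with pw p(2) show ?thesis by simp
  qed
  then obtain R where R: "R ** Q = mat 1"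
    using matrix_left_invertible_ker[of Q] by blast
  then have RQ: "R *v (Q *v w) = w" for w
    by (metis matrix_vector_mul_assoc matrix_vector_mul_lid)
  have QR: "Q ** R = mat 1" using R matrix_left_right_inverse by blast
  have R1: "R *v 1 = 1"
    using RQ[of 1] by (simp add: Q p(2) L_def laplace_one)
  \<comment> \<open>Both vectors have the same product with the invertible \<open>Q\<close>.
    Uniqueness resolves the description in \<open>left_null_vec\<close>.\<close>
  have unique: "v' = p" if "v' v* L = 0" "v' \<bullet> 1 = 1" for v'
  proof -
    have "(v' v* Q) \<bullet> w = p \<bullet> w" for w
    proof -
      have "v' \<bullet> (L *v w) = 0" using that(1) by (metis dot_lmul_matrix inner_zero_left)
      then show ?thesis
        using that(2) by (simp add: dot_lmul_matrix Q inner_add_right)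
    qed
    moreover have "(p v* Q) \<bullet> w = p \<bullet> w" for w
      using p(2) by (simp add: dot_lmul_matrix Q inner_add_right pL)
    ultimately have "v' v* Q = p v* Q" by (subst vector_eq_rdot[symmetric]) simp
    then have "(v' v* Q) v* R = (p v* Q) v* R" by simp
    then show ?thesis by (simp only: vector_matrix_mul_assoc QR vector_matrix_mul_rid)
  qed
  have v: "v = p"
    unfolding v_def left_null_vec_def sp L_def[symmetric]
    by (rule the_equality) (use p unique in blast)+
  show "v v* L = 0" using p v by simp
  have "R *v (L *v (L *v w)) = L *v w" for w
    using RQ[of "L *v w"] by (simp add: Q pL)
  then have "R ** L ** L = L"
    by (simp add: matrix_eq matrix_vector_mul_assoc[symmetric])
  moreover have "w = R *v (L *v w) + (v \<bullet> w) *\<^sub>R 1" for w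
    using RQ[of w] by (simp add: Q v matrix_vector_right_distrib matrix_vector_mult_scaleR R1)
  ultimately show "\<exists>R. R ** L ** L = L \<and> (\<forall>w. w = R *v (L *v w) + (v \<bullet> w) *\<^sub>R 1)"
    by blast
qed

subsection \<open>The matrix exponential\<close>

lemma matrix_power_commute: "M ** matrix_power M k = matrix_power M k ** M"
  by (induction k) (simp_all add: matrix_mul_assoc)

lemma matrix_power_scaleR: "matrix_power (t *\<^sub>R M) k = t ^ k *\<^sub>R matrix_power M k"
  for M :: "real^'n^'n"
  by (induction k) (simp_all add: vec_eq_iff matrix_matrix_mult_def sum_distrib_left mult_ac)

text \<open>\<open>K\<close> bounds left multiplication by \<open>M\<close>, so the powers grow at
  most geometrically and the exponential series of \<open>K\<close> dominates.\<close>

lemma summable_matrix_power_series: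
  fixes M :: "real^'n^'n"
  shows "summable (\<lambda>k. (1 / fact k) *\<^sub>R matrix_power M k)"
proof -
  obtain K where K: "K > 0" "\<And>X :: real^'n^'n. norm (M ** X) \<le> norm X * K"
    using bounded_linear.pos_bounded[OF bounded_linear_matrix_mult_left[of M]] by blast
  have "norm (matrix_power M k) \<le> norm (mat 1 :: real^'n^'n) * K ^ k" for k
  proof (induction k)
    case (Suc k)
    have "norm (matrix_power M (Suc k)) \<le> norm (matrix_power M k) * K"
      using K(2) by simp
    also have "\<dots> \<le> (norm (mat 1 :: real^'n^'n) * K ^ k) * K"
      using Suc K(1) by (intro mult_right_mono) auto
    finally show ?case by (simp add: mult_ac)
  qed simp
  then have le: "norm ((1 / fact k) *\<^sub>R matrix_power M k)
      \<le> norm (mat 1 :: real^'n^'n) * (K ^ k /\<^sub>R fact k)" for k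
    by (simp add: field_simps)
  have "summable (\<lambda>k. norm (mat 1 :: real^'n^'n) * (K ^ k /\<^sub>R fact k))"
    by (intro summable_mult summable_exp_generic)
  then show ?thesis
    using le by (rule summable_comparison_test'[where N = 0])
qed

text \<open>Each entry becomes a real power series in \<open>t\<close>, to which differentiation
  term by term applies.\<close>

lemma matrix_exp_component_sums:
  fixes M :: "real^'n^'n"
  shows "(\<lambda>k. matrix_power M k $ i $ j / fact k * t ^ k) sums matrix_exp (t *\<^sub>R M) $ i $ j"
proof -
  have "(\<lambda>k. (1 / fact k) *\<^sub>R matrix_power (t *\<^sub>R M) k) sums matrix_exp (t *\<^sub>R M)"
    unfolding matrix_exp_def by (intro summable_sums summable_matrix_power_series)
  then have "(\<lambda>k. ((1 / fact k) *\<^sub>R matrix_power (t *\<^sub>R M) k) $ i $ j) sums matrix_exp (t *\<^sub>R M) $ i $ j"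
    by (intro bounded_linear.sums[OF bounded_linear_vec_nth])
  then show ?thesis
    by (simp add: matrix_power_scaleR field_simps)
qed

lemma matrix_exp_0: "matrix_exp 0 = (mat 1 :: real^'n^'n)"
proof -
  \<comment> \<open>The zero matrix is viewed as \<open>0 *\<^sub>R mat 1\<close>; at
    \<open>t = 0\<close> only the term with index \<open>0\<close> survives.\<close>
  have "(\<lambda>k. matrix_power (mat 1) k $ i $ j / fact k * 0 ^ k) sums (mat 1 :: real^'n^'n) $ i $ j" for i j
    using powser_sums_zero[of "\<lambda>k. matrix_power (mat 1 :: real^'n^'n) k $ i $ j / fact k"] by simp
  moreover have "(\<lambda>k. matrix_power (mat 1) k $ i $ j / fact k * 0 ^ k) sums matrix_exp 0 $ i $ j" for i j :: 'n
    using matrix_exp_component_sums[of "mat 1" i j 0] by simp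
  ultimately show ?thesis
    unfolding vec_eq_iff using sums_unique2 by blast
qed

text \<open>\<open>diffs\<close> shifts the index and cancels one factor of the factorial. The extra
  factor \<open>M\<close> is moved to the right, where \<open>linear_ode_solution\<close> needs
  it.\<close>

lemma matrix_exp_has_derivative:
  fixes M :: "real^'n^'n"
  shows "((\<lambda>t. matrix_exp (t *\<^sub>R M) $ i $ j) has_real_derivative
           (matrix_exp (t *\<^sub>R M) ** M) $ i $ j) (at t)"
proof -
  define a where "a = (\<lambda>i j k. matrix_power M k $ i $ j / fact k)"
  have a: "(\<lambda>k. a i j k * t ^ k) sums matrix_exp (t *\<^sub>R M) $ i $ j" for i j t
    using matrix_exp_component_sums by (simp add: a_def)
  have "diffs (a i j) k * t ^ k = (\<Sum>l\<in>UNIV. (a i l k * t ^ k) * M $ l $ j)" for k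
  proof -
    have "diffs (a i j) k = matrix_power M (Suc k) $ i $ j / fact k"
      by (simp add: diffs_def a_def del: matrix_power.simps of_nat_Suc)
    also have "\<dots> = (\<Sum>l\<in>UNIV. a i l k * M $ l $ j)"
      by (simp add: matrix_power_commute)
         (simp add: matrix_matrix_mult_def a_def sum_divide_distrib)
    finally show ?thesis by (simp add: sum_distrib_left sum_distrib_right mult_ac)
  qed
  moreover have "(\<lambda>k. \<Sum>l\<in>UNIV. (a i l k * t ^ k) * M $ l $ j) sums (\<Sum>l\<in>UNIV. matrix_exp (t *\<^sub>R M) $ i $ l * M $ l $ j)"
    by (intro sums_sum sums_mult2 a)
  ultimately have "(\<Sum>k. diffs (a i j) k * t ^ k) = (matrix_exp (t *\<^sub>R M) ** M) $ i $ j"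
    by (simp add: matrix_matrix_mult_def sums_iff)
  moreover have "((\<lambda>t. \<Sum>k. a i j k * t ^ k) has_real_derivative (\<Sum>k. diffs (a i j) k * t ^ k)) (at t)"
    using a by (intro termdiffs_strong_converges_everywhere) (auto simp: sums_iff)
  moreover have "(\<lambda>t. \<Sum>k. a i j k * t ^ k) = (\<lambda>t. matrix_exp (t *\<^sub>R M) $ i $ j)"
    using a by (auto simp: sums_iff)
  ultimately show ?thesis by simp
qed

text \<open>Along a solution \<open>c\<close>, the map \<open>s \<mapsto> exp ((T - s) M) c(s)\<close> is constant.\<close>

lemma linear_ode_solution:
  fixes M :: "real^'n^'n"
  assumes ode: "\<And>t. t \<ge> 0 \<Longrightarrow> (c has_vector_derivative (M *v c t)) (at t within {0..})"
    and T: "T \<ge> 0"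
  shows "c T = matrix_exp (T *\<^sub>R M) *v c 0"
proof -
  define e where "e = (\<lambda>s. matrix_exp ((T - s) *\<^sub>R M) *v c s)"
  have "e T $ i = e 0 $ i" for i
  proof -
    have der: "((\<lambda>s. e s $ i) has_real_derivative 0) (at s within {0..T})" if "s \<in> {0..T}" for s
    proof -
      have c: "((\<lambda>s. c s $ j) has_real_derivative (M *v c s) $ j) (at s within {0..T})" for j
        unfolding has_real_derivative_iff_has_vector_derivative
        using that
        by (intro bounded_linear.has_vector_derivative[OF bounded_linear_vec_nth]
            has_vector_derivative_within_subset[OF ode]) auto
      have x: "((\<lambda>s. matrix_exp ((T - s) *\<^sub>R M) $ i $ j) has_real_derivative
          - (matrix_exp ((T - s) *\<^sub>R M) ** M) $ i $ j) (at s within {0..T})" for j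
      proof -
        have "((\<lambda>s. T - s) has_real_derivative - 1) (at s within {0..T})"
          by (auto intro!: derivative_eq_intros)
        from DERIV_chain2[OF matrix_exp_has_derivative this] show ?thesis by simp
      qed
      have "((\<lambda>s. \<Sum>j\<in>UNIV. matrix_exp ((T - s) *\<^sub>R M) $ i $ j * c s $ j) has_real_derivative
          (\<Sum>j\<in>UNIV. - (matrix_exp ((T - s) *\<^sub>R M) ** M) $ i $ j * c s $ j +
            (M *v c s) $ j * matrix_exp ((T - s) *\<^sub>R M) $ i $ j)) (at s within {0..T})"
        by (intro DERIV_sum DERIV_mult x c)
      moreover have "(\<Sum>j\<in>UNIV. - (matrix_exp ((T - s) *\<^sub>R M) ** M) $ i $ j * c s $ j +
            (M *v c s) $ j * matrix_exp ((T - s) *\<^sub>R M) $ i $ j)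
          = (matrix_exp ((T - s) *\<^sub>R M) *v (M *v c s)) $ i - ((matrix_exp ((T - s) *\<^sub>R M) ** M) *v c s) $ i"
        by (simp add: matrix_vector_mult_def[of _ "c s"] matrix_vector_mult_def[of "matrix_exp _"]
            sum_subtractf mult_ac)
      moreover have "e = (\<lambda>s. \<chi> i. \<Sum>j\<in>UNIV. matrix_exp ((T - s) *\<^sub>R M) $ i $ j * c s $ j)"
        by (simp add: e_def matrix_vector_mult_def)
      ultimately show ?thesis
        by (simp add: matrix_vector_mul_assoc)
    qed
    have "\<exists>k. \<forall>s\<in>{0..T}. e s $ i = k"
      using der by (intro has_field_derivative_zero_constant) auto
    then show ?thesis using T by (metis atLeastAtMost_iff order_refl)
  qed
  then have "e T = e 0" by (simp add: vec_eq_iff)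
  then show ?thesis by (simp add: e_def matrix_exp_0)
qed

subsection \<open>Determinants\<close>

text \<open>Let \<open>R\<close> be the identity with column \<open>a\<close> replaced by
  \<open>u\<close>. Then \<open>(1 + u h\<^sup>T) R = R T\<close>, where \<open>T\<close> differs
  from the identity only in row \<open>a\<close>. Cramer's lemma gives both determinants, and
  \<open>det R = u $ a\<close> can be cancelled.\<close>

lemma det_identity_plus_rank_one:
  fixes u h :: "'a::field^'n"
  shows "det (mat 1 + (\<chi> i j. u $ i * h $ j)) = 1 + (\<Sum>i\<in>UNIV. h $ i * u $ i)"
proof (cases "u = 0")
  case True
  have "(\<chi> i j. 0 * h $ j) = (0 :: 'a^'n^'n)" by (simp add: vec_eq_iff)
  with True show ?thesis by simp
next
  case False
  then obtain a where a: "u $ a \<noteq> 0" by (auto simp: vec_eq_iff)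
  define R :: "'a^'n^'n" where "R = (\<chi> i j. if j = a then u $ i else mat 1 $ i $ j)"
  define r :: "'a^'n" where "r = h v* R"
  define T :: "'a^'n^'n" where "T = mat 1 + (\<chi> i j. if i = a then r $ j else 0)"
  have "R ** (\<chi> i j. if i = a then r $ j else 0) = (\<chi> i j. u $ i * r $ j)"
    by (simp add: vec_eq_iff matrix_matrix_mult_def R_def if_distrib[of "\<lambda>x. _ * x"] cong: if_cong)
  moreover have "(\<chi> i j. u $ i * h $ j) ** R = (\<chi> i j. u $ i * r $ j)"
    by (simp add: vec_eq_iff matrix_matrix_mult_def r_def vector_matrix_mult_def sum_distrib_left mult_ac)
  ultimately have "(mat 1 + (\<chi> i j. u $ i * h $ j)) ** R = R ** T"
    by (simp add: T_def matrix_add_ldistrib matrix_add_rdistrib)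
  then have "det (mat 1 + (\<chi> i j. u $ i * h $ j)) * det R = det R * det T"
    by (metis det_mul)
  moreover have "det R = u $ a"
    using cramer_lemma[of a "mat 1" u] by (simp add: R_def cong: if_cong)
  moreover have "det T = 1 + r $ a"
  proof -
    have "transpose T = (\<chi> i j. if j = a then (axis a 1 + r) $ i else mat 1 $ i $ j)"
      by (simp add: T_def transpose_def vec_eq_iff mat_def axis_def)
    then have "det (transpose T) = 1 + r $ a"
      using cramer_lemma[of a "mat 1" "axis a 1 + r"] by (simp add: axis_def cong: if_cong)
    then show ?thesis by (simp add: det_transpose)
  qed
  moreover have "r $ a = (\<Sum>i\<in>UNIV. h $ i * u $ i)"
    by (simp add: r_def vector_matrix_mult_def R_def mult.commute)
  ultimately show ?thesis using a by simp
qed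

text \<open>The matrix determinant lemma, by factoring \<open>M\<close> out of the sum.\<close>

lemma det_rank_one_update:
  fixes M :: "'a::field^'n^'n"
  assumes "det M \<noteq> 0"
  shows "det (M + (\<chi> i j. u $ i * h $ j)) = det M * (1 + (\<Sum>i\<in>UNIV. h $ i * (matrix_inv M *v u) $ i))"
proof -
  have "\<exists>M'. M ** M' = mat 1 \<and> M' ** M = mat 1"
    using assms invertible_det_nz[of M] by (simp add: invertible_def)
  then have inv: "M ** matrix_inv M = mat 1"
    unfolding matrix_inv_def by (rule someI2_ex) simp
  then have "M *v (matrix_inv M *v u) = u"
    by (simp add: matrix_vector_mul_assoc)
  then have "M ** (\<chi> i j. (matrix_inv M *v u) $ i * h $ j) = (\<chi> i j. u $ i * h $ j)"
    by (simp add: vec_eq_iff matrix_matrix_mult_def matrix_vector_mult_def[of M]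
        mult.assoc[symmetric] sum_distrib_right[symmetric])
  then have "M + (\<chi> i j. u $ i * h $ j) = M ** (mat 1 + (\<chi> i j. (matrix_inv M *v u) $ i * h $ j))"
    by (simp add: matrix_add_ldistrib)
  then show ?thesis
    by (simp add: det_mul det_identity_plus_rank_one)
qed

text \<open>Serves to extend a determinant identity to the eigenvalues of \<open>A\<close>, where
  \<open>matrix_inv\<close> is unspecified.\<close>

lemma continuous_det_shift:
  fixes M :: "'a::real_normed_field^'n^'n"
  shows "continuous_on UNIV (\<lambda>s. det (mat s - M))"
proof -
  have "continuous_on UNIV (\<lambda>s. (mat s - M) $ i $ j)" for i j
    by (cases "i = j") (auto simp: mat_def intro!: continuous_intros)
  then show ?thesis
    unfolding det_def by (intro continuous_on_sum continuous_on_mult continuous_on_prod continuous_on_const)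
qed

section \<open>Real polynomials at complex points, and the characteristic polynomial\<close>

lemma cpoly_pCons: "cpoly (pCons a p) s = complex_of_real a + s * cpoly p s"
  by (simp add: map_poly_pCons)

lemma cpoly_add: "cpoly (p + q) s = cpoly p s + cpoly q s"
  by (induction p q rule: poly_induct2) (simp_all add: cpoly_pCons algebra_simps)

lemma cpoly_smult: "cpoly (smult c p) s = complex_of_real c * cpoly p s"
  by (induction p) (simp_all add: cpoly_pCons algebra_simps)

lemma cpoly_mult: "cpoly (p * q) s = cpoly p s * cpoly q s"
  by (induction p) (simp_all add: cpoly_pCons cpoly_add cpoly_smult algebra_simps)

lemma cpoly_sum: "cpoly (sum f S) s = (\<Sum>x\<in>S. cpoly (f x) s)"
  by (induction S rule: infinite_finite_induct) (simp_all add: cpoly_add)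

lemma cpoly_prod: "cpoly (prod f S) s = (\<Prod>x\<in>S. cpoly (f x) s)"
  by (induction S rule: infinite_finite_induct) (simp_all add: cpoly_mult)

lemma cpoly_of_int: "cpoly (of_int k) s = of_int k"
  by (simp add: of_int_poly map_poly_pCons)

lemma cpoly_charpoly: "cpoly (charpoly A) s = det (mat s - cmatrix A)"
proof -
  have "cpoly ((mat [:0, 1:] - map_matrix (\<lambda>a. [:a:]) A) $ i $ j) s = (mat s - cmatrix A) $ i $ j" for i j
    by (simp add: mat_def map_poly_pCons)
  then show ?thesis
    by (simp add: charpoly_def det_def cpoly_sum cpoly_mult cpoly_prod cpoly_of_int)
qed

lemma finite_cpoly_roots:
  assumes "p \<noteq> 0"
  shows "finite {s. cpoly p s = 0}"
  using assms by (intro poly_roots_finite) (simp add: map_poly_eq_0_iff)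

text \<open>In the Leibniz sum the term of a permutation has at most the degree given by its number
  of fixed points, so only the identity, a product of monic factors, reaches degree
  \<open>CARD('n)\<close>.\<close>

lemma charpoly_monic:
  fixes A :: "real^'n^'n"
  shows "degree (charpoly A) = CARD('n)" "lead_coeff (charpoly A) = 1"
proof -
  define X where "X = mat [:0, 1:] - map_matrix (\<lambda>a. [:a:]) A"
  have X: "X $ i $ j = (if i = j then [:- A $ i $ j, 1:] else [:- A $ i $ j:])" for i j
    by (simp add: X_def mat_def)
  define f where "f = (\<lambda>\<pi>. of_int (sign \<pi>) * (\<Prod>i\<in>UNIV. X $ i $ \<pi> i))"
  have char: "charpoly A = (\<Sum>\<pi> | \<pi> permutes UNIV. f \<pi>)"
    by (simp add: charpoly_def det_def X_def f_def)
  have deg: "degree (f \<pi>) \<le> (\<Sum>i\<in>UNIV. if i = \<pi> i then 1 else 0)" for \<pi>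
  proof -
    have "degree (f \<pi>) \<le> degree (\<Prod>i\<in>UNIV. X $ i $ \<pi> i)"
      using degree_mult_le[of "of_int (sign \<pi>)" "\<Prod>i\<in>UNIV. X $ i $ \<pi> i"]
      by (simp add: f_def)
    also have "\<dots> \<le> (\<Sum>i\<in>UNIV. degree (X $ i $ \<pi> i))"
      using degree_prod_sum_le[of UNIV "\<lambda>i. X $ i $ \<pi> i"] by (simp add: o_def)
    also have "\<dots> \<le> (\<Sum>i\<in>UNIV. if i = \<pi> i then 1 else 0)"
      by (intro sum_mono) (simp add: X)
    finally show ?thesis .
  qed
  have other: "coeff (f \<pi>) CARD('n) = 0" if \<pi>: "\<pi> \<noteq> id" for \<pi>
  proof -
    obtain i where "i \<noteq> \<pi> i" using \<pi> by (metis eq_id_iff)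
    then have "(\<Sum>i\<in>UNIV. if i = \<pi> i then 1 else 0) < (\<Sum>i\<in>(UNIV :: 'n set). 1 :: nat)"
      by (intro sum_strict_mono_ex1) auto
    with deg[of \<pi>] show ?thesis by (intro coeff_eq_0) simp
  qed
  have f_id: "f id = (\<Prod>i\<in>UNIV. [:- A $ i $ i, 1:])"
    by (simp add: f_def X)
  have "degree (f id) = CARD('n)"
    unfolding f_id by (subst degree_prod_eq_sum_degree) auto
  moreover have "lead_coeff (f id) = 1"
    unfolding f_id lead_coeff_prod by simp
  ultimately have id: "coeff (f id) CARD('n) = 1" by simp
  have "coeff (charpoly A) CARD('n) = (\<Sum>\<pi> | \<pi> permutes (UNIV :: 'n set). if \<pi> = id then 1 else 0)"
    unfolding char coeff_sum using other id by (intro sum.cong) auto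
  also have "\<dots> = 1"
    by (simp add: permutes_id finite_permutations)
  finally have coeff: "coeff (charpoly A) CARD('n) = 1" .
  have "degree (f \<pi>) \<le> CARD('n)" for \<pi>
  proof -
    have "(\<Sum>i\<in>UNIV. if i = \<pi> i then 1 else 0) \<le> (\<Sum>i\<in>(UNIV :: 'n set). 1 :: nat)"
      by (intro sum_mono) auto
    with deg[of \<pi>] show ?thesis by simp
  qed
  then have "degree (charpoly A) \<le> CARD('n)"
    unfolding char by (intro degree_sum_le) (auto simp: finite_permutations)
  with coeff show "degree (charpoly A) = CARD('n)"
    by (metis le_degree le_antisym zero_neq_one)
  with coeff show "lead_coeff (charpoly A) = 1" by simp
qed

subsection \<open>Real part of the reciprocal transfer function\<close>

text \<open>Division with remainder: the quotient is linear because the degrees differ by one, and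
  the remainder gives a proper fraction. This isolates \<open>\<alpha> * z\<close>, the only term
  unbounded at infinity.\<close>

lemma quotient_decomposition:
  fixes d p :: "real poly"
  assumes deg: "degree d = Suc (degree p)" and lead: "lead_coeff d > 0" "lead_coeff p > 0"
  obtains \<alpha> \<beta> q where "\<alpha> > 0"
    and "\<And>z. cpoly p z \<noteq> 0 \<Longrightarrow>
      cpoly d z / cpoly p z = complex_of_real \<alpha> * z + complex_of_real \<beta> + cpoly q z / cpoly p z"
    and "((\<lambda>z. cpoly q z / cpoly p z) \<longlongrightarrow> 0) at_infinity"
proof -
  define Q q where "Q = d div p" and "q = d mod p"
  have p0: "p \<noteq> 0" using lead by auto
  have dQ: "d = Q * p + q" by (simp add: Q_def q_def)
  \<comment> \<open>For constant \<open>p\<close>, the case \<open>n = 1\<close>, the remainder is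
    \<open>0\<close> and the strict inequality of degrees fails.\<close>
  have q: "q = 0 \<or> degree q < degree p"
    using degree_mod_less[OF p0] by (simp add: q_def)
  have "Q \<noteq> 0"
    using deg q dQ by auto
  have "degree q < degree (Q * p)" if "degree q < degree p"
    using that p0 \<open>Q \<noteq> 0\<close> by (simp add: degree_mult_eq)
  then have "degree d = degree (Q * p)"
    using q dQ by (metis add.right_neutral degree_add_eq_left)
  then have "degree Q = 1"
    using deg p0 \<open>Q \<noteq> 0\<close> by (simp add: degree_mult_eq)
  define \<alpha> \<beta> where "\<alpha> = coeff Q 1" and "\<beta> = coeff Q 0"
  have Q: "Q = [:\<beta>, \<alpha>:]"
    using \<open>degree Q = 1\<close>
    by (intro poly_eqI) (auto simp: \<alpha>_def \<beta>_def coeff_pCons coeff_eq_0 split: nat.split)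
  have "\<alpha> \<noteq> 0"
    using \<open>degree Q = 1\<close> by (auto simp: Q split: if_splits)
  have "degree q < degree (Q * p)"
    using q p0 \<open>degree Q = 1\<close> \<open>Q \<noteq> 0\<close> by (auto simp: degree_mult_eq)
  then have "lead_coeff d = lead_coeff (Q * p)"
    unfolding dQ by (simp add: degree_add_eq_left coeff_eq_0)
  then have "lead_coeff d = \<alpha> * lead_coeff p"
    using \<open>\<alpha> \<noteq> 0\<close> by (simp only: lead_coeff_mult) (simp add: Q)
  then have "\<alpha> > 0" using lead by (simp add: zero_less_mult_iff)
  moreover have "cpoly d z / cpoly p z = complex_of_real \<alpha> * z + complex_of_real \<beta> + cpoly q z / cpoly p z"
    if "cpoly p z \<noteq> 0" for z
    using that by (simp add: dQ Q cpoly_add cpoly_mult cpoly_smult cpoly_pCons field_simps del: mult_pCons_left)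
  moreover have "((\<lambda>z. cpoly q z / cpoly p z) \<longlongrightarrow> 0) at_infinity"
    using q
  proof
    assume "degree q < degree p"
    then show ?thesis
      by (intro poly_divide_tendsto_0_at_infinity) (simp add: degree_map_poly)
  qed simp
  ultimately show ?thesis using that by blast
qed

text \<open>On the imaginary axis \<open>\<alpha> * z\<close> has real part \<open>0\<close>. The
  remaining fraction is continuous there, \<open>p\<close> having no imaginary root, and is small
  far out. Boundedness makes the supremum in \<open>kappa0\<close> an upper bound.\<close>

lemma bdd_above_Re_reciprocal:
  fixes d p :: "real poly"
  assumes deg: "degree d = Suc (degree p)" and lead: "lead_coeff d > 0" "lead_coeff p > 0"
    and hurwitz: "hurwitz_poly p"
  shows "bdd_above (range (\<lambda>\<omega>::real. Re (- (cpoly d (\<i> * \<omega>) / cpoly p (\<i> * \<omega>)))))"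
proof -
  obtain \<alpha> \<beta> q where "\<alpha> > 0" and dec: "\<And>z. cpoly p z \<noteq> 0 \<Longrightarrow>
      cpoly d z / cpoly p z = complex_of_real \<alpha> * z + complex_of_real \<beta> + cpoly q z / cpoly p z"
    and lim: "((\<lambda>z. cpoly q z / cpoly p z) \<longlongrightarrow> 0) at_infinity"
    using quotient_decomposition[OF deg lead] by blast
  have nz: "cpoly p (\<i> * complex_of_real \<omega>) \<noteq> 0" for \<omega>
    using hurwitz by (auto simp: hurwitz_poly_def)
  have "\<forall>\<^sub>F z in at_infinity. cmod (cpoly q z / cpoly p z) < 1"
    using tendstoD[OF lim, of 1] by simp
  then obtain r where r: "\<And>z. cmod z \<ge> r \<Longrightarrow> cmod (cpoly q z / cpoly p z) < 1"
    by (auto simp: eventually_at_infinity)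
  have "compact ((\<lambda>\<omega>. cmod (cpoly q (\<i> * complex_of_real \<omega>) / cpoly p (\<i> * complex_of_real \<omega>))) ` {-r..r})"
    using nz by (intro compact_continuous_image continuous_intros) auto
  then have "bounded ((\<lambda>\<omega>. cmod (cpoly q (\<i> * complex_of_real \<omega>) / cpoly p (\<i> * complex_of_real \<omega>))) ` {-r..r})"
    by (rule compact_imp_bounded)
  then obtain b where b: "\<forall>\<omega>\<in>{-r..r}.
      cmod (cpoly q (\<i> * complex_of_real \<omega>) / cpoly p (\<i> * complex_of_real \<omega>)) \<le> b"
    by (auto simp: bounded_iff)
  show ?thesis
  proof (intro bdd_aboveI2[where M = "- \<beta> + max b 1"])
    fix \<omega> :: real
    define R where "R = cpoly q (\<i> * complex_of_real \<omega>) / cpoly p (\<i> * complex_of_real \<omega>)"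
    have "cmod R \<le> max b 1"
    proof (cases "\<omega> \<in> {-r..r}")
      case True
      then show ?thesis unfolding R_def using b by (meson max.coboundedI1)
    next
      case False
      then have "cmod (\<i> * complex_of_real \<omega>) \<ge> r" by (auto simp: norm_mult)
      then show ?thesis using r[of "\<i> * complex_of_real \<omega>"] by (simp add: R_def)
    qed
    moreover have "- Re R \<le> cmod R" using abs_Re_le_cmod[of R] by linarith
    ultimately show "Re (- (cpoly d (\<i> * \<omega>) / cpoly p (\<i> * \<omega>))) \<le> - \<beta> + max b 1"
      using dec[OF nz[of \<omega>]] by (simp add: R_def[symmetric])
  qed
qed

text \<open>
  Maximum principle on a half disc for \<open>- \<beta> - q/p\<close>, the part of \<open>- d/p\<close> that stays bounded at
  infinity; the discarded term \<open>- \<alpha> z\<close> has nonpositive real part.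
\<close>

lemma Re_reciprocal_le:
  fixes d p :: "real poly"
  assumes deg: "degree d = Suc (degree p)" and lead: "lead_coeff d > 0" "lead_coeff p > 0"
    and hurwitz: "hurwitz_poly p"
    and K: "\<And>\<omega>::real. Re (- (cpoly d (\<i> * \<omega>) / cpoly p (\<i> * \<omega>))) \<le> K"
    and z: "Re z \<ge> 0"
  shows "Re (- (cpoly d z / cpoly p z)) \<le> K"
proof -
  obtain \<alpha> \<beta> q where "\<alpha> > 0" and dec: "\<And>z. cpoly p z \<noteq> 0 \<Longrightarrow>
      cpoly d z / cpoly p z = complex_of_real \<alpha> * z + complex_of_real \<beta> + cpoly q z / cpoly p z"
    and lim: "((\<lambda>z. cpoly q z / cpoly p z) \<longlongrightarrow> 0) at_infinity"
    using quotient_decomposition[OF deg lead] by blast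
  have nz: "cpoly p w \<noteq> 0" if "Re w \<ge> 0" for w
    using hurwitz that by (auto simp: hurwitz_poly_def not_less[symmetric])
  define F where "F = (\<lambda>w. - complex_of_real \<beta> - cpoly q w / cpoly p w)"
  have F: "Re (- (cpoly d w / cpoly p w)) = Re (F w) - \<alpha> * Re w" if "Re w \<ge> 0" for w
    using dec[OF nz[OF that]] by (simp add: F_def)
  have axis: "Re (F w) \<le> K" if "Re w = 0" for w
  proof -
    have "w = \<i> * complex_of_real (Im w)" using that by (simp add: complex_eq_iff)
    then show ?thesis using K[of "Im w"] F[of w] that by simp
  qed
  \<comment> \<open>On a large arc \<open>F\<close> is only close to \<open>- \<beta>\<close>, hence
    the slack \<open>e\<close>.\<close>
  have "Re (F z) \<le> K + e" if "e > 0" for e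
  proof -
    have "\<forall>\<^sub>F z in at_infinity. cmod (cpoly q z / cpoly p z) < e / 2"
      using tendstoD[OF lim, of "e / 2"] that by simp
    then obtain r0 where r0: "\<And>z. cmod z \<ge> r0 \<Longrightarrow> cmod (cpoly q z / cpoly p z) < e / 2"
      by (auto simp: eventually_at_infinity)
    define r where "r = max (max r0 (cmod z)) 0"
    have far: "\<bar>Re (F w) + \<beta>\<bar> < e / 2" if "cmod w = r" for w
    proof -
      have "cmod (cpoly q w / cpoly p w) < e / 2"
        using that by (intro r0) (simp add: r_def)
      moreover have "Re (F w) + \<beta> = - Re (cpoly q w / cpoly p w)" by (simp add: F_def)
      ultimately show ?thesis
        using abs_Re_le_cmod[of "cpoly q w / cpoly p w"] by linarith
    qed
    \<comment> \<open>The point \<open>\<i> r\<close> lies both on the arc and on the axis, so the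
      bound \<open>K\<close> on the axis limits \<open>- \<beta>\<close> as well.\<close>
    have "cmod (\<i> * complex_of_real r) = r"
      by (simp add: norm_mult r_def)
    from far[OF this] have "- \<beta> \<le> K + e / 2"
      using axis[of "\<i> * complex_of_real r"] unfolding abs_less_iff by simp
    define S where "S = cball 0 r \<inter> {w. 0 \<le> Re w}"
    have "closed S"
      unfolding S_def by (intro closed_Int closed_cball closed_halfspace_Re_ge)
    have S_nz: "cpoly p w \<noteq> 0" if "w \<in> S" for w
      using nz that by (simp add: S_def)
    show ?thesis
    proof (rule maximum_real_frontier[of F S])
      show "F holomorphic_on interior S"
        unfolding F_def using S_nz interior_subset[of S]
        by (intro holomorphic_intros) auto
      show "continuous_on (closure S) F"
        unfolding F_def closure_closed[OF \<open>closed S\<close>] using S_nz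
        by (intro continuous_intros) auto
      show "bounded S"
        unfolding S_def by (intro bounded_Int disjI1 bounded_cball)
      show "z \<in> S" using z by (simp add: S_def r_def)
      \<comment> \<open>A point of \<open>S\<close> neither on the arc nor on the axis is interior,
        so these two bounds cover the frontier.\<close>
      fix w assume w: "w \<in> frontier S"
      then have "w \<in> S" using \<open>closed S\<close> by (meson frontier_subset_closed subsetD)
      show "Re (F w) \<le> K + e"
      proof (cases "cmod w = r \<or> Re w = 0")
        case True
        then show ?thesis
        proof
          assume "cmod w = r"
          then show ?thesis using far[of w] \<open>- \<beta> \<le> K + e / 2\<close> by linarith
        next
          assume "Re w = 0"
          then show ?thesis using axis[of w] that by simp
        qed
      next
        case False
        then have "w \<in> ball 0 r \<inter> {w. 0 < Re w}"
          using \<open>w \<in> S\<close> by (auto simp: S_def)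
        moreover have "open (ball 0 r \<inter> {w. 0 < Re w})"
          by (intro open_Int open_ball open_halfspace_Re_gt)
        moreover have "ball 0 r \<inter> {w. 0 < Re w} \<subseteq> S"
          by (auto simp: S_def)
        ultimately have "w \<in> interior S" by (meson interiorI)
        with w show ?thesis by (simp add: frontier_def)
      qed
    qed
  qed
  then have "Re (F z) \<le> K" by (rule field_le_epsilon)
  moreover have "\<alpha> * Re z \<ge> 0" using \<open>\<alpha> > 0\<close> z by simp
  ultimately show ?thesis using F[OF z] by linarith
qed

subsection \<open>The closed loop\<close>

text \<open>Two numerators agree off the finitely many roots of the characteristic polynomial, hence
  at infinitely many points. This resolves the description in
  \<open>reciprocal_transfer\<close>.\<close>

lemma is_numerator_unique:
  assumes "is_numerator A B C g p" "is_numerator A B C g p'"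
  shows "p = p'"
proof (rule ccontr)
  assume "p \<noteq> p'"
  then have "finite {s. cpoly (p - p') s = 0}"
    by (intro finite_cpoly_roots) simp
  moreover have "charpoly A \<noteq> 0"
    using charpoly_monic(2)[of A] by auto
  then have "finite {s. cpoly (charpoly A) s = 0}"
    by (rule finite_cpoly_roots)
  moreover have "cpoly (p - p') s = 0" if "cpoly (charpoly A) s \<noteq> 0" for s
  proof -
    have "cpoly p s / cpoly (charpoly A) s = cpoly p' s / cpoly (charpoly A) s"
      using assms that by (simp add: is_numerator_def)
    then have "cpoly p s = cpoly p' s" using that by simp
    moreover have "cpoly p s = cpoly (p - p') s + cpoly p' s"
      by (subst cpoly_add[symmetric]) simp
    ultimately show ?thesis by simp
  qed
  then have "UNIV = {s. cpoly (p - p') s = 0} \<union> {s. cpoly (charpoly A) s = 0}" by auto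
  ultimately have "finite (UNIV :: complex set)" by (metis finite_Un)
  then show False using infinite_UNIV_char_0 by blast
qed

text \<open>The gain is complex because \<open>\<kappa>\<close> stands for \<open>k\<close> times an
  eigenvalue of the Laplace matrix.\<close>

definition closed_loop :: "real^'n^'n \<Rightarrow> real^'n \<Rightarrow> real^'n \<Rightarrow> complex \<Rightarrow> complex^'n^'n" where
  "closed_loop A B h \<kappa> = cmatrix A - (\<chi> i j. \<kappa> * B $ i * h $ j)"

text \<open>Off the eigenvalues of \<open>A\<close> this is the matrix determinant lemma, whose sum
  is \<open>\<kappa>\<close> times the transfer function. Both sides are continuous and the excluded
  set is finite, so the identity holds everywhere.\<close>

lemma det_closed_loop:
  assumes "is_numerator A B C g p"
  shows "det (mat s - closed_loop A B (C *v g) \<kappa>) = cpoly (charpoly A) s + \<kappa> * cpoly p s"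
proof -
  define Z where "Z = {s. cpoly (charpoly A) s = 0}"
  define f where "f = (\<lambda>s. det (mat s - closed_loop A B (C *v g) \<kappa>) - (cpoly (charpoly A) s + \<kappa> * cpoly p s))"
  have "f s = 0" if "s \<in> - Z" for s
  proof -
    define M where "M = mat s - cmatrix A"
    have d: "det M = cpoly (charpoly A) s" by (simp add: M_def cpoly_charpoly)
    then have "det M \<noteq> 0" using that by (simp add: Z_def)
    define m where "m = matrix_inv M *v cvector B"
    have "scalar_product (cvector g) (transfer A B C s) = (\<Sum>l\<in>UNIV. \<Sum>i\<in>UNIV. of_real (g $ l) * (of_real (C $ i $ l) * m $ i))"
      by (simp add: scalar_product_def transfer_def M_def[symmetric] m_def[symmetric]
          vector_matrix_mult_def sum_distrib_left mult.commute)
    also have "\<dots> = (\<Sum>i\<in>UNIV. \<Sum>l\<in>UNIV. of_real (g $ l) * (of_real (C $ i $ l) * m $ i))"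
      by (rule sum.swap)
    also have "\<dots> = (\<Sum>i\<in>UNIV. cvector (C *v g) $ i * m $ i)"
      by (simp add: matrix_vector_mult_def sum_distrib_right sum_distrib_left mult_ac)
    finally have num: "(\<Sum>i\<in>UNIV. cvector (C *v g) $ i * m $ i) = cpoly p s / det M"
      using assms that by (simp add: is_numerator_def Z_def d)
    have "mat s - closed_loop A B (C *v g) \<kappa> = M + (\<chi> i j. (\<kappa> *s cvector B) $ i * cvector (C *v g) $ j)"
      by (simp add: closed_loop_def M_def vec_eq_iff)
    moreover have "matrix_inv M *v (\<kappa> *s cvector B) = \<kappa> *s m"
      by (simp add: m_def vector_scalar_commute)
    ultimately have "det (mat s - closed_loop A B (C *v g) \<kappa>)
        = det M * (1 + (\<Sum>i\<in>UNIV. cvector (C *v g) $ i * (\<kappa> *s m) $ i))"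
      by (simp only: det_rank_one_update[OF \<open>det M \<noteq> 0\<close>])
    also have "(\<Sum>i\<in>UNIV. cvector (C *v g) $ i * (\<kappa> *s m) $ i) = \<kappa> * (cpoly p s / det M)"
      unfolding num[symmetric] by (simp add: sum_distrib_left mult_ac)
    finally show ?thesis
      using \<open>det M \<noteq> 0\<close> by (simp add: f_def d field_simps)
  qed
  moreover have "closure (- Z) = UNIV"
  proof -
    have "charpoly A \<noteq> 0"
      using charpoly_monic(2)[of A] by auto
    then have "interior Z = {}"
      unfolding Z_def by (intro empty_interior_finite finite_cpoly_roots)
    then show ?thesis by (simp add: closure_complement)
  qed
  moreover have "continuous_on UNIV f"
    unfolding f_def by (intro continuous_intros continuous_det_shift)
  ultimately have "f s = 0"
    using continuous_constant_on_closure[of "- Z" f 0 s] by simp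
  then show ?thesis by (simp add: f_def)
qed

text \<open>With \<open>d = charpoly A\<close>, an eigenvalue \<open>z\<close> in the closed right
  half-plane would satisfy \<open>- d(z)/p(z) = \<kappa>\<close>, where \<open>p(z)\<close> is
  nonzero as \<open>p\<close> is Hurwitz. But the real part of the left-hand side is at most
  \<open>kappa0 A B C g\<close>.\<close>

lemma closed_loop_stable:
  fixes A :: "real^'n^'n"
  assumes hmp: "hyper_minimum_phase A B C g"
    and \<kappa>: "Re \<kappa> > kappa0 A B C g"
    and ev: "eigenvalue (closed_loop A B (C *v g) \<kappa>) z"
  shows "Re z < 0"
proof (rule ccontr)
  assume "\<not> Re z < 0"
  then have z: "Re z \<ge> 0" by simp
  obtain p where p: "is_numerator A B C g p" "hurwitz_poly p" "degree p = CARD('n) - 1"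
    and "\<And>i. i \<le> degree p \<Longrightarrow> coeff p i > 0"
    using hmp unfolding hyper_minimum_phase_def by blast
  then have lead: "lead_coeff (charpoly A) > 0" "lead_coeff p > 0"
    using charpoly_monic(2)[of A] by simp_all
  have deg: "degree (charpoly A) = Suc (degree p)"
    by (simp add: charpoly_monic(1) p(3))
  have recip: "reciprocal_transfer A B C g s = cpoly (charpoly A) s / cpoly p s" for s
    using the_equality[of "is_numerator A B C g" p] p(1) is_numerator_unique
    by (metis reciprocal_transfer_def)
  have "Re (- (cpoly (charpoly A) (\<i> * \<omega>) / cpoly p (\<i> * \<omega>))) \<le> kappa0 A B C g" for \<omega> :: real
    unfolding kappa0_def recip
    by (rule cSUP_upper[OF _ bdd_above_Re_reciprocal[OF deg lead p(2)]]) simp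
  then have le: "Re (- (cpoly (charpoly A) z / cpoly p z)) \<le> kappa0 A B C g"
    by (rule Re_reciprocal_le[OF deg lead p(2) _ z])
  obtain w where "w \<noteq> 0" "closed_loop A B (C *v g) \<kappa> *v w = z *s w"
    using ev by (auto simp: eigenvalue_def)
  then have "(mat z - closed_loop A B (C *v g) \<kappa>) *v w = 0"
    by (simp add: matrix_vector_mult_diff_rdistrib mat_mult_vector)
  then have "det (mat z - closed_loop A B (C *v g) \<kappa>) = 0"
    using \<open>w \<noteq> 0\<close> invertible_det_nz matrix_left_invertible_ker invertible_def by metis
  then have "cpoly (charpoly A) z + \<kappa> * cpoly p z = 0"
    by (simp add: det_closed_loop[OF p(1)])
  moreover have "cpoly p z \<noteq> 0"
    using p(2) z by (auto simp: hurwitz_poly_def not_less[symmetric])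
  ultimately have "- (cpoly (charpoly A) z / cpoly p z) = \<kappa>"
    by (simp add: field_simps add_eq_0_iff)
  with le \<kappa> show False by simp
qed

subsection \<open>Consensus\<close>

lemma has_vector_derivative_vecI:
  fixes f :: "real \<Rightarrow> 'a::real_normed_vector^'n"
  assumes "\<And>i. ((\<lambda>t. f t $ i) has_vector_derivative f' $ i) (at t within S)"
  shows "(f has_vector_derivative f') (at t within S)"
  unfolding has_vector_derivative_def has_derivative_within
proof
  show "((\<lambda>y. (1 / norm (y - t)) *\<^sub>R (f y - (f t + (y - t) *\<^sub>R f'))) \<longlongrightarrow> 0) (at t within S)"
    using assms unfolding has_vector_derivative_def has_derivative_within
    by (intro vec_tendstoI) simp
qed (rule bounded_linear_scaleR_left)

lemma cmatrix_mult: "cmatrix (X ** Y) = cmatrix X ** cmatrix Y"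
  by (simp add: vec_eq_iff matrix_matrix_mult_def)

lemma eigenvalue_cmatrix: "eigenvalue (cmatrix M) z \<longleftrightarrow> complex_eigenvalue M z"
  by (simp add: eigenvalue_def complex_eigenvalue_def)

text \<open>The eigenvalue \<open>\<mu>\<close> makes the set under \<open>Min\<close> nonempty, so
  the minimum is attained and hence positive. Then \<open>k > 0\<close> gives
  \<open>k * r_min L \<le> k * Re \<mu>\<close>, with \<open>L\<close> the Laplace matrix.\<close>

lemma gain_exceeds_kappa0:
  fixes E :: "('v::finite \<times> 'v) set"
  assumes k: "k > kappa0 A B C g / r_min (laplace_matrix E)" "k > 0"
    and \<mu>: "eigenvalue (cmatrix (laplace_matrix E)) \<mu>" "\<mu> \<noteq> 0"
  shows "k * Re \<mu> > kappa0 A B C g"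
proof -
  define Z where "Z = {z. complex_eigenvalue (laplace_matrix E) z \<and> z \<noteq> 0}"
  have "finite Z"
    using finite_eigenvalues[of "cmatrix (laplace_matrix E)"]
    by (simp add: Z_def eigenvalue_cmatrix)
  have "\<mu> \<in> Z" using \<mu> by (simp add: Z_def eigenvalue_cmatrix)
  have r: "r_min (laplace_matrix E) = Min (Re ` Z)"
    by (simp add: r_min_def Z_def)
  have "Min (Re ` Z) \<in> Re ` Z"
    using \<open>finite Z\<close> \<open>\<mu> \<in> Z\<close> by (intro Min_in) auto
  then have "r_min (laplace_matrix E) > 0"
    using laplace_eigenvalue_Re_pos by (auto simp: r Z_def eigenvalue_cmatrix)
  then have "kappa0 A B C g < k * r_min (laplace_matrix E)"
    using k(1) by (simp add: field_simps)
  also have "\<dots> \<le> k * Re \<mu>"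
    unfolding r using \<open>finite Z\<close> \<open>\<mu> \<in> Z\<close> k(2) by simp
  finally show ?thesis .
qed

text \<open>
  The agents are the rows of \<open>W\<close>.  When \<open>L W - \<mu> W\<close> vanishes asymptotically, the dynamics of \<open>W\<close>
  is up to a vanishing input that of the closed loop with gain \<open>k \<mu>\<close>.  The eigenvalue \<open>0\<close> is
  harmless on the range of \<open>L\<close>, where \<open>L\<close> is injective.
\<close>

lemma laplace_image_tendsto_zero:
  fixes E :: "('v::finite \<times> 'v) set" and A :: "real^'n^'n" and W :: "real \<Rightarrow> complex^'n^'v"
  assumes hmp: "hyper_minimum_phase A B C g"
    and span: "has_directed_spanning_tree E"
    and k: "k > kappa0 A B C g / r_min (laplace_matrix E)" "k > 0"
  defines "L \<equiv> cmatrix (laplace_matrix E)"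
    and "H \<equiv> (\<chi> i j. complex_of_real (k * (C *v g) $ i * B $ j))"
  assumes ode: "\<And>t. t \<ge> 0 \<Longrightarrow>
      (W has_vector_derivative (W t ** transpose (cmatrix A) - L ** W t ** H)) (at t within {0..})"
  shows "((\<lambda>t. L ** W t) \<longlongrightarrow> 0) at_top"
proof -
  \<comment> \<open>The network equation is abstracted from \<open>W\<close> because it also holds
    for images of solutions under matrices commuting with \<open>L\<close>.\<close>
  define sol where "sol = (\<lambda>W. \<forall>t\<ge>0.
      (W has_vector_derivative (W t ** transpose (cmatrix A) - L ** W t ** H)) (at t within {0..}))"
  have sol_mult: "sol (\<lambda>t. M ** W t)" if W: "sol W" and comm: "M ** L = L ** M" for M W
    unfolding sol_def
  proof (intro allI impI)
    fix t :: real assume "t \<ge> 0"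
    have "((\<lambda>t. M ** W t) has_vector_derivative
        M ** (W t ** transpose (cmatrix A) - L ** W t ** H)) (at t within {0..})"
      using W \<open>t \<ge> 0\<close> unfolding sol_def
      by (intro bounded_linear.has_vector_derivative[OF bounded_linear_matrix_mult_left]) simp
    then show "((\<lambda>t. M ** W t) has_vector_derivative
        (M ** W t ** transpose (cmatrix A) - L ** (M ** W t) ** H)) (at t within {0..})"
      by (simp add: matrix_diff_ldistrib matrix_mul_assoc comm)
  qed
  have shift_comm: "(L - mat \<mu>) ** L = L ** (L - mat \<mu>)" for \<mu>
    by (simp add: matrix_diff_ldistrib matrix_diff_rdistrib mat_mult_commute)
  obtain R0 where R0: "R0 ** laplace_matrix E ** laplace_matrix E = laplace_matrix E"
    using left_null_vec_laplace(2)[OF span] by blast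
  define R where "R = cmatrix R0"
  have R: "R ** L ** L = L"
    using arg_cong[OF R0, of cmatrix] by (simp only: cmatrix_mult R_def L_def)
  show ?thesis
  proof (rule tendsto_zero_by_eigenvalues[where M = L and S = "{\<lambda>t. L ** W t | W. sol W}"])
    show "(\<lambda>t. L ** W t) \<in> {\<lambda>t. L ** W t | W. sol W}"
      using ode by (auto simp: sol_def)
  next
    fix F :: "real \<Rightarrow> complex^'n^'v" and \<mu>
    assume "F \<in> {\<lambda>t. L ** W t | W. sol W}"
    then obtain W where W: "sol W" and F: "F = (\<lambda>t. L ** W t)" by blast
    show "(\<lambda>t. (L - mat \<mu>) ** F t) \<in> {\<lambda>t. L ** W t | W. sol W}"
      using sol_mult[OF W shift_comm, of \<mu>]
      by (intro CollectI exI[of _ "\<lambda>t. (L - mat \<mu>) ** W t"]) (simp add: F matrix_mul_assoc shift_comm)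
    assume ev: "eigenvalue L \<mu>" and lim: "((\<lambda>t. (L - mat \<mu>) ** F t) \<longlongrightarrow> 0) at_top"
    show "(F \<longlongrightarrow> 0) at_top"
    proof (cases "\<mu> = 0")
      case True
      have "R ** ((L - mat 0) ** F t) = F t" for t
        by (simp add: F mat_0 matrix_mul_assoc R)
      then show ?thesis
        using tendsto_matrix_mult_zero[OF lim, of R] True by simp
    next
      case False
      define K where "K = closed_loop A B (C *v g) (complex_of_real k * \<mu>)"
      have K: "K = cmatrix A - transpose (mat \<mu> ** H)"
        by (simp add: K_def closed_loop_def vec_eq_iff transpose_def mat_mult_component H_def mult_ac)
      \<comment> \<open>After transposition the states are columns. Replacing \<open>L F\<close> by
        \<open>\<mu> F\<close> leaves the closed loop \<open>K\<close>, and the error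
        \<open>(L - \<mu>) F\<close> is collected in \<open>V\<close>.\<close>
      define V where "V = (\<lambda>t. - transpose H ** transpose ((L - mat \<mu>) ** F t))"
      have "sol F" using sol_mult[OF W, of L] by (simp add: F)
      have ode_F: "((\<lambda>t. transpose (F t)) has_vector_derivative (K ** transpose (F t) + V t)) (at t within {0..})"
        if "t \<ge> 0" for t
      proof -
        have "((\<lambda>t. transpose (F t)) has_vector_derivative
            transpose (F t ** transpose (cmatrix A) - L ** F t ** H)) (at t within {0..})"
          using \<open>sol F\<close> that unfolding sol_def
          by (intro bounded_linear.has_vector_derivative[OF bounded_linear_transpose]) simp
        moreover have "transpose (F t ** transpose (cmatrix A) - L ** F t ** H) = K ** transpose (F t) + V t"
        proof -
          have "L ** F t ** H = (L - mat \<mu>) ** F t ** H + F t ** (mat \<mu> ** H)"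
            by (simp add: matrix_diff_rdistrib matrix_mul_assoc mat_mult_commute[of \<mu> "F t"])
          then have "transpose (F t ** transpose (cmatrix A) - L ** F t ** H)
              = transpose (F t ** transpose (cmatrix A)) - transpose ((L - mat \<mu>) ** F t ** H)
                - transpose (F t ** (mat \<mu> ** H))"
            by (simp add: vec_eq_iff transpose_def)
          also have "\<dots> = cmatrix A ** transpose (F t) - transpose H ** transpose ((L - mat \<mu>) ** F t)
                - transpose (mat \<mu> ** H) ** transpose (F t)"
            by (simp only: matrix_transpose_mul transpose_transpose)
          also have "\<dots> = K ** transpose (F t) + V t"
            by (simp add: K V_def matrix_diff_rdistrib)
               (simp add: vec_eq_iff matrix_matrix_mult_def sum_negf)
          finally show ?thesis .
        qed
        ultimately show ?thesis by simp
      qed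
      have V: "(V \<longlongrightarrow> 0) at_top"
        unfolding V_def
        by (intro tendsto_matrix_mult_zero bounded_linear.tendsto_zero[OF bounded_linear_transpose] lim)
      have stable: "Re \<nu> < 0" if "eigenvalue K \<nu>" for \<nu>
      proof (rule closed_loop_stable[OF hmp _ that[unfolded K_def]])
        show "Re (complex_of_real k * \<mu>) > kappa0 A B C g"
          using gain_exceeds_kappa0[OF k ev[unfolded L_def] False] by simp
      qed
      have "((\<lambda>t. transpose (F t)) \<longlongrightarrow> 0) at_top"
        by (rule matrix_ode_tendsto_zero[OF stable ode_F V])
      then have "((\<lambda>t. transpose (transpose (F t))) \<longlongrightarrow> 0) at_top"
        by (rule bounded_linear.tendsto_zero[OF bounded_linear_transpose])
      then show ?thesis by (simp add: transpose_transpose)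
    qed
  qed
qed

text \<open>Turns the Kronecker expression into the weighted sum of states that is followed along
  solutions.\<close>

lemma row_kronecker_id_col: "row_kronecker_id v (col z) = (\<Sum>i\<in>UNIV. v $ i *\<^sub>R z i)"
proof (simp add: vec_eq_iff, intro allI)
  fix j
  have "row_kronecker_id v (col z) $ j
      = (\<Sum>q\<in>UNIV \<times> UNIV. v $ fst q * (if j = snd q then 1 else 0) * z (fst q) $ snd q)"
    by (simp add: row_kronecker_id_def kronecker_def matrix_vector_mult_def rowvector_def col_def mat_def)
  also have "\<dots> = (\<Sum>i\<in>UNIV. \<Sum>l\<in>UNIV. v $ i * (if j = l then 1 else 0) * z i $ l)"
    by (simp add: sum.cartesian_product case_prod_unfold)
  also have "\<dots> = (\<Sum>i\<in>UNIV. v $ i * z i $ j)"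
    by (intro sum.cong refl) (simp add: if_distrib[of "\<lambda>x. _ * x"] if_distrib[of "\<lambda>x. x * _"] cong: if_cong)
  finally show "row_kronecker_id v (col z) $ j = (\<Sum>i\<in>UNIV. v $ i * z i $ j)" .
qed

theorem theorem1:
  fixes A :: "real^'n^'n" and B :: "real^'n" and C :: "real^'l^'n" and g :: "real^'l"
    and E :: "('v::finite \<times> 'v) set" and k :: real
    and x :: "'v \<Rightarrow> real \<Rightarrow> real^'n"
    and y ybar :: "'v \<Rightarrow> real \<Rightarrow> real^'l"
    and u :: "'v \<Rightarrow> real \<Rightarrow> real"
  assumes N: "CARD('v) \<ge> 2"
    and hmp: "hyper_minimum_phase A B C g"
    and loopfree: "irrefl E"
    and spanning: "has_directed_spanning_tree E"
    and state: "\<And>i t. t \<ge> 0 \<Longrightarrow>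
        (x i has_vector_derivative (A *v x i t + u i t *s B)) (at t within {0..})"
    and outp: "\<And>i t. t \<ge> 0 \<Longrightarrow> y i t = transpose C *v x i t"
    and ybar: "\<And>i t. t \<ge> 0 \<Longrightarrow> ybar i t = (\<Sum>j\<in>neighbours E i. y i t - y j t)"
    and control: "\<And>i t. t \<ge> 0 \<Longrightarrow> u i t = - k * (g \<bullet> ybar i t)"
    and k_pos: "k > 0"
    and k_large: "k > kappa0 A B C g / r_min (laplace_matrix E)"
  shows "(\<forall>i j. ((\<lambda>t. x i t - x j t) \<longlongrightarrow> 0) at_top) \<and>
         (\<forall>i. ((\<lambda>t. x i t - matrix_exp (t *\<^sub>R A) *v
              row_kronecker_id (left_null_vec (laplace_matrix E)) (col (\<lambda>i. x i 0))) \<longlongrightarrow> 0) at_top)"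
proof -
  define L where "L = laplace_matrix E"
  define v where "v = left_null_vec L"
  define h where "h = C *v g"
  define \<eta> :: "real \<Rightarrow> real^'v" where "\<eta> = (\<lambda>t. \<chi> i. h \<bullet> x i t)"
  have u: "u i t = - k * (L *v \<eta> t) $ i" if "t \<ge> 0" for i t
  proof -
    have "g \<bullet> (y i t - y j t) = h \<bullet> x i t - h \<bullet> x j t" for j
    proof -
      have "g \<bullet> y j t = h \<bullet> x j t" for j
        using outp[OF that] by (simp add: h_def inner_commute[of g] dot_lmul_matrix inner_commute[of "x j t"])
      then show ?thesis by (simp add: inner_diff_right)
    qed
    then have "g \<bullet> ybar i t = (L *v \<eta> t) $ i"
      by (simp add: ybar[OF that] inner_sum_right L_def laplace_component \<eta>_def)
    then show ?thesis by (simp add: control[OF that])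
  qed
  obtain R where R: "\<And>w. w = R *v (L *v w) + (v \<bullet> w) *\<^sub>R 1"
    using left_null_vec_laplace(2)[OF spanning] unfolding L_def v_def by metis
  have vL: "v \<bullet> (L *v w) = 0" for w
    using left_null_vec_laplace(1)[OF spanning] unfolding L_def v_def
    by (metis dot_lmul_matrix inner_zero_left)

  \<comment> \<open>The real trajectories are embedded into the complex numbers because eigenvalues
    of \<open>L\<close> may be nonreal.\<close>
  define W :: "real \<Rightarrow> complex^'n^'v" where "W = (\<lambda>t. \<chi> i a. complex_of_real (x i t $ a))"
  have LW: "(cmatrix L ** W t) $ i $ a = complex_of_real ((L *v (\<chi> j. x j t $ a)) $ i)" for t i a
    by (simp add: matrix_matrix_mult_def matrix_vector_mult_def W_def)
  define H where "H = (\<chi> i j. complex_of_real (k * h $ i * B $ j))"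
  have "(W has_vector_derivative (W t ** transpose (cmatrix A) - cmatrix L ** W t ** H)) (at t within {0..})"
    if t: "t \<ge> 0" for t
  proof (intro has_vector_derivative_vecI)
    fix i a
    have "((\<lambda>t. complex_of_real (x i t $ a)) has_vector_derivative
        complex_of_real ((A *v x i t + u i t *s B) $ a)) (at t within {0..})"
      by (intro bounded_linear.has_vector_derivative[OF bounded_linear_of_real]
          bounded_linear.has_vector_derivative[OF bounded_linear_vec_nth] state t)
    moreover have "complex_of_real ((A *v x i t + u i t *s B) $ a)
        = (W t ** transpose (cmatrix A) - cmatrix L ** W t ** H) $ i $ a"
    proof -
      have "(W t ** transpose (cmatrix A)) $ i $ a = complex_of_real ((A *v x i t) $ a)"
        by (simp add: matrix_matrix_mult_def matrix_vector_mult_def W_def transpose_def mult.commute)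
      moreover have "(cmatrix L ** W t ** H) $ i $ a = complex_of_real (k * (L *v \<eta> t) $ i * B $ a)"
      proof -
        \<comment> \<open>Applying \<open>L\<close> across agents commutes with contracting by
          \<open>h\<close> across state coordinates.\<close>
        have "(L *v \<eta> t) $ i = (\<Sum>b\<in>UNIV. (L *v (\<chi> j. x j t $ b)) $ i * h $ b)"
        proof -
          have "(\<Sum>b\<in>UNIV. (L *v (\<chi> j. x j t $ b)) $ i * h $ b)
              = (\<Sum>b\<in>UNIV. \<Sum>j\<in>UNIV. L $ i $ j * (h $ b * x j t $ b))"
            by (simp add: matrix_vector_mult_def sum_distrib_right sum_distrib_left mult_ac)
          also have "\<dots> = (\<Sum>j\<in>UNIV. \<Sum>b\<in>UNIV. L $ i $ j * (h $ b * x j t $ b))"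
            by (rule sum.swap)
          also have "\<dots> = (L *v \<eta> t) $ i"
            by (simp add: matrix_vector_mult_def \<eta>_def inner_vec_def sum_distrib_left)
          finally show ?thesis by simp
        qed
        moreover have "(cmatrix L ** W t ** H) $ i $ a
            = complex_of_real (\<Sum>b\<in>UNIV. (L *v (\<chi> j. x j t $ b)) $ i * (k * h $ b * B $ a))"
          by (simp add: matrix_matrix_mult_def[of "_ ** _"] LW H_def)
        ultimately show ?thesis
          by (simp add: sum_distrib_left sum_distrib_right mult_ac)
      qed
      ultimately show ?thesis using u[OF t] by simp
    qed
    ultimately show "((\<lambda>t. W t $ i $ a) has_vector_derivative
        (W t ** transpose (cmatrix A) - cmatrix L ** W t ** H) $ i $ a) (at t within {0..})"
      by (simp add: W_def)
  qed
  then have "((\<lambda>t. cmatrix L ** W t) \<longlongrightarrow> 0) at_top"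
    unfolding L_def H_def h_def by (rule laplace_image_tendsto_zero[OF hmp spanning k_large k_pos])
  then have "((\<lambda>t. (cmatrix L ** W t) $ i $ a) \<longlongrightarrow> 0 $ i $ a) at_top" for i a
    by (intro tendsto_vec_nth)
  then have "((\<lambda>t. complex_of_real ((L *v (\<chi> j. x j t $ a)) $ i)) \<longlongrightarrow> complex_of_real 0) at_top" for i a
    by (simp add: LW)
  then have "((\<lambda>t. (L *v (\<chi> j. x j t $ a)) $ i) \<longlongrightarrow> 0) at_top" for i a
    by (simp only: tendsto_of_real_iff)
  then have LX: "((\<lambda>t. L *v (\<chi> j. x j t $ a)) \<longlongrightarrow> 0) at_top" for a
    by (intro vec_tendstoI) simp

  \<comment> \<open>The weighted mean of the states. The controls cancel in its derivative because
    \<open>v\<close> is a left null vector of \<open>L\<close>.\<close>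
  define c where "c = (\<lambda>t. \<Sum>i\<in>UNIV. v $ i *\<^sub>R x i t)"
  have c_comp: "c t $ a = v \<bullet> (\<chi> j. x j t $ a)" for t a
    by (simp add: c_def inner_vec_def)
  have to_c: "((\<lambda>t. x i t - c t) \<longlongrightarrow> 0) at_top" for i
  proof (intro vec_tendstoI)
    fix a
    \<comment> \<open>By the choice of \<open>R\<close>, the deviation from \<open>c\<close> is a
      fixed linear image of \<open>L\<close> applied to the states.\<close>
    have "(x i t - c t) $ a = (R *v (L *v (\<chi> j. x j t $ a))) $ i" for t
      using arg_cong[OF R[of "\<chi> j. x j t $ a"], of "\<lambda>w. w $ i"] by (simp add: c_comp)
    moreover have "((\<lambda>t. (R *v (L *v (\<chi> j. x j t $ a))) $ i) \<longlongrightarrow> 0 $ i) at_top"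
      by (intro tendsto_vec_nth bounded_linear.tendsto_zero[OF matrix_vector_mul_bounded_linear] LX)
    ultimately show "((\<lambda>t. (x i t - c t) $ a) \<longlongrightarrow> 0 $ a) at_top" by simp
  qed
  have c_ode: "(c has_vector_derivative (A *v c t)) (at t within {0..})" if t: "t \<ge> 0" for t
  proof -
    have "(c has_vector_derivative (\<Sum>i\<in>UNIV. v $ i *\<^sub>R (A *v x i t + u i t *s B))) (at t within {0..})"
      unfolding c_def
      by (intro has_vector_derivative_sum bounded_linear.has_vector_derivative[OF bounded_linear_scaleR_right] state t)
    moreover have "(\<Sum>i\<in>UNIV. v $ i *\<^sub>R (A *v x i t + u i t *s B)) = A *v c t"
    proof -
      have "(\<Sum>i\<in>UNIV. v $ i * u i t) = - k * (v \<bullet> (L *v \<eta> t))"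
        by (simp add: u[OF t] inner_vec_def sum_distrib_left mult_ac sum_negf)
      then have "(\<Sum>i\<in>UNIV. v $ i * u i t) = 0" by (simp add: vL)
      then have "(\<Sum>i\<in>UNIV. v $ i *\<^sub>R (u i t *s B)) = 0"
        by (simp add: vec_eq_iff mult.assoc[symmetric] sum_distrib_right[symmetric])
      moreover have "A *v c t = (\<Sum>i\<in>UNIV. v $ i *\<^sub>R (A *v x i t))"
        by (simp add: c_def linear_sum[OF matrix_vector_mul_linear] matrix_vector_mult_scaleR)
      ultimately show ?thesis by (simp add: scaleR_add_right sum.distrib)
    qed
    ultimately show ?thesis by simp
  qed
  have c_exp: "c t = matrix_exp (t *\<^sub>R A) *v c 0" if "t \<ge> 0" for t
    by (rule linear_ode_solution[OF c_ode that])
  have "((\<lambda>t. x i t - matrix_exp (t *\<^sub>R A) *v row_kronecker_id v (col (\<lambda>i. x i 0))) \<longlongrightarrow> 0) at_top" for i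
  \<comment> \<open>The closed form of \<open>c\<close> is available for \<open>t \<ge> 0\<close>
    only.\<close>
  proof (rule Lim_transform_eventually[OF to_c])
    show "\<forall>\<^sub>F t in at_top. x i t - c t = x i t - matrix_exp (t *\<^sub>R A) *v row_kronecker_id v (col (\<lambda>i. x i 0))"
      using eventually_ge_at_top[of 0]
    proof eventually_elim
      case (elim t)
      then have "c t = matrix_exp (t *\<^sub>R A) *v c 0" by (rule c_exp)
      then show ?case by (simp add: row_kronecker_id_col c_def)
    qed
  qed
  moreover have "((\<lambda>t. x i t - x j t) \<longlongrightarrow> 0) at_top" for i j
    using tendsto_diff[OF to_c[of i] to_c[of j]] by simp
  ultimately show ?thesis unfolding v_def L_def by blast
qed

end
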